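(* Let $\psi_-\in X$ and, for $\varepsilon\in\,]0,1]$, let $r^\varepsilon\in X$. Suppose that Assumptions 1 and 4 (stated in the context) are satisfied. Let $\delta>\alpha(p-1)$, let $u^\varepsilon$ be the solution of $$L(\varepsilon\partial)u^\varepsilon=\varepsilon^{\delta}F\left(\frac{x}{\varepsilon},u^\varepsilon\right),\qquad u^\varepsilon(0,x)=A_-(\psi_-)\left(\frac{-1}{\varepsilon},\frac{x}{\varepsilon}\right)+r^\varepsilon(x),$$ and let $w^\varepsilon$ be the solution of $$L(\varepsilon\partial)w^\varepsilon=0,\qquad w^\varepsilon(0,x)=A_-(\psi_-)\left(\frac{-1}{\varepsilon},\frac{x}{\varepsilon}\right).$$ Assume that $\|r^\varepsilon\|_{X,\varepsilon}\to0$ as $\varepsilon\to0$. Then for $\varepsilon$ sufficiently small, $u^\varepsilon\in C(\mathbb{R}_+;X)$ and $$\sup_{t\ge0}\|u^\varepsilon(t,\cdot)-w^\varepsilon(t,\cdot)\|_{X,\varepsilon}\to0\quad\text{as }\varepsilon\to0.$$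
   Context: Setting. $L(\partial)=\partial_t+p(\partial_{x_1},\dots,\partial_{x_n})$ is a constant-coefficient differential operator acting on functions $\psi:\mathbb{R}\times\mathbb{R}^n\to\mathbb{C}^q$, where $p(\cdot)$ is a polynomial with coefficients in $\mathcal{M}_q(\mathbb{C})$; $L(\varepsilon\partial)=\varepsilon\partial_t+p(\varepsilon\partial_{x_1},\dots,\varepsilon\partial_{x_n})$. $X$ is a Banach space of functions of $x\in\mathbb{R}^n$ with values in $\mathbb{C}^q$, invariant under dilations: if $\varphi\in X$ then $\varphi(\lambda\,\cdot)\in X$ for all $\lambda>0$. The nonlinearity $F(x,z)$ is $p$-homogeneous in its last variable for some real number $p>1$ (the exponent $p$ is unrelated to the polynomial $p(\cdot)$): $F(x,\lambda z)=\lambda^pF(x,z)$ for all $(x,\lambda,z)\in\mathbb{R}^n\times\mathbb{R}_+^*\times\mathbb{C}^q$. Assumption 1. (a) The problem $L(\partial)\psi=0$, $\psi|_{t=0}=\varphi\in X$, has a unique solution $\psi\in C(\mathbb{R};X)$, and there is a group $U_0$, unitary (i.e. norm preserving) on $X$, such that $\psi(t)=U_0(t)\varphi$ for all $t\in\mathbb{R}$. (b) There exists $\alpha\ge0$ such that for every $\varphi\in\mathcal{S}(\mathbb{R}^n;\mathbb{C}^q)$ there exist $c_\pm=c_\pm(\varphi)<\infty$ with $\limsup_{t\to\pm\infty}|t|^\alpha\|U_0(t)\varphi\|_{L^\infty(\mathbb{R}^n,\mathbb{C}^q)}=c_\pm$, and there exist $\varphi_\pm$ such that $c_\pm$ are nonzero.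 (c) There exist mappings $A_\pm:X\to C(\mathbb{R};X)$, written $A_\pm(\varphi)(t,x)$, such that for every $\varphi\in X$, $\left\|\varphi-U_0(-t)\left(|t|^{-\alpha}A_\pm(\varphi)(t,\cdot)\right)\right\|_X\to0$ as $t\to\pm\infty$. Assumption 4. There exists $T<\infty$ such that for any $t_0\in[-\infty,-T]$ and any $\psi_-$ small enough in $X$, the Cauchy problem $L(\partial)\psi=F(x,\psi)$, $U_0(-t)\psi(t)|_{t=t_0}=\psi_-$, has a unique solution $\psi\in C(\mathbb{R};X)$. Moreover, there exists $C=C(\|\psi_-\|_X)$, independent of $t_0\in[-\infty,-T]$, such that $$\sup_{t>t_0}\|U_0(-t)\psi(t,\cdot)-\psi_-\|_X\le C(\|\psi_-\|_X)\,\|\psi_-\|_X,\qquad\text{with }C(\lambda)\to0\text{ as }\lambda\to0.$$ For $\varphi\in X$, $\varepsilon\in\,]0,1]$: $\|\varphi\|_{X,\varepsilon}:=\|\varepsilon^\alpha\varphi(\varepsilon\,\cdot)\|_X$. Meaning of the $\varepsilon$-dependent problems: with $\beta=\delta/(p-1)$, $u^\varepsilon$ solves its problem iff $\psi^\varepsilon$, defined by $u^\varepsilon(t,x)=\varepsilon^{-\beta}\psi^\varepsilon\left(\frac{t-1}{\varepsilon},\frac{x}{\varepsilon}\right)$, solves $L(\partial)\psi^\varepsilon=F(x,\psi^\varepsilon)$ with $\psi^\varepsilon\left(-\frac1\varepsilon,x\right)=\varepsilon^\beta A_-(\psi_-)\left(\frac{-1}{\varepsilon},x\right)+\varepsilon^\beta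 r^\varepsilon(\varepsilon x)$. Likewise $w^\varepsilon(t,\varepsilon\,\cdot)=U_0(t/\varepsilon)A_-(\psi_-)\left(\frac{-1}{\varepsilon},\cdot\right)$. *)

theory Defs
  imports "HOL-Analysis.Analysis" "HOL-Probability.Essential_Supremum" "HOL-Library.Poly_Mapping"
begin

section \<open>Smooth functions\<close>

definition deriv_along :: "'a::real_normed_vector \<Rightarrow> ('a \<Rightarrow> 'b::real_normed_vector) \<Rightarrow> 'a \<Rightarrow> 'b" where
  "deriv_along v f = (\<lambda>z. frechet_derivative f (at z) v)"

text \<open>The list \<open>vs\<close> names the directions of an iterated derivative.\<close>

definition iterated_deriv :: "'a::real_normed_vector list \<Rightarrow> ('a \<Rightarrow> 'b::real_normed_vector) \<Rightarrow> 'a \<Rightarrow> 'b" where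
  "iterated_deriv vs f = foldr deriv_along vs f"

text \<open>If all iterated partial derivatives exist and are differentiable then they are continuous,
  so this is the usual class \<open>C\<^sup>\<infinity>\<close>.\<close>

definition smooth :: "('a::euclidean_space \<Rightarrow> 'b::real_normed_vector) \<Rightarrow> bool" where
  "smooth f \<longleftrightarrow> (\<forall>vs. set vs \<subseteq> Basis \<longrightarrow> iterated_deriv vs f differentiable_on UNIV)"

definition test_function :: "('a::euclidean_space \<Rightarrow> complex) \<Rightarrow> bool" where
  "test_function \<phi> \<longleftrightarrow> smooth \<phi> \<and> compact (closure {z. \<phi> z \<noteq> 0})"

definition schwartz :: "('a::euclidean_space \<Rightarrow> 'b::real_normed_vector) \<Rightarrow> bool" where
  "schwartz f \<longleftrightarrow> smooth f \<and>
     (\<forall>k vs. set vs \<subseteq> Basis \<longrightarrow> bounded (range (\<lambda>x. norm x ^ k *\<^sub>R iterated_deriv vs f x)))"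

definition locally_integrable :: "('a::euclidean_space \<Rightarrow> 'b::euclidean_space) \<Rightarrow> bool" where
  "locally_integrable f \<longleftrightarrow> (\<forall>K. compact K \<longrightarrow> set_integrable lebesgue K f)"

section \<open>The differential operator\<close>

text \<open>A polynomial in the variables \<open>(X\<^sub>i)\<close>, indexed by the finite type \<open>'n\<close>, with coefficients in
  the \<open>q \<times> q\<close> complex matrices: finitely many multi-indices carry a nonzero coefficient.\<close>

type_synonym ('n, 'q) matrix_poly = "('n \<Rightarrow> nat) \<Rightarrow>\<^sub>0 complex ^ 'q ^ 'q"

text \<open>Space-time points are pairs \<open>(t, x)\<close>.  For a multi-index \<open>a\<close>, \<open>space_deriv a \<phi>\<close> is
  \<open>\<partial>\<^sub>x\<close> to the power \<open>a\<close> applied to \<open>\<phi>\<close>, taken along some word that contains each letter \<open>i\<close> exactly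
  \<open>a i\<close> times; for smooth \<open>\<phi>\<close> the order of the letters is irrelevant.\<close>

definition space_deriv ::
    "('n::finite \<Rightarrow> nat) \<Rightarrow> (real \<times> (real ^ 'n) \<Rightarrow> complex) \<Rightarrow> real \<times> (real ^ 'n) \<Rightarrow> complex" where
  "space_deriv a \<phi> =
     iterated_deriv (map (\<lambda>i. (0, axis i 1)) (SOME l. \<forall>i. count_list l i = a i)) \<phi>"

definition time_deriv :: "(real \<times> (real ^ 'n::finite) \<Rightarrow> complex) \<Rightarrow> real \<times> (real ^ 'n) \<Rightarrow> complex" where
  "time_deriv \<phi> = deriv_along (1, 0) \<phi>"

text \<open>The equation \<open>\<epsilon> \<partial>\<^sub>t v + P(\<epsilon> \<partial>\<^sub>x) v = f\<close> on \<open>\<real> \<times> \<real>\<^sup>n\<close> in the sense of distributions; each derivative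
  moved to the test function produces a sign.\<close>

definition weak_equation ::
    "('n::finite, 'q::finite) matrix_poly \<Rightarrow> real \<Rightarrow> (real \<times> (real ^ 'n) \<Rightarrow> complex ^ 'q) \<Rightarrow>
      (real \<times> (real ^ 'n) \<Rightarrow> complex ^ 'q) \<Rightarrow> bool" where
  "weak_equation P \<epsilon> v f \<longleftrightarrow>
     (\<forall>\<phi>. test_function \<phi> \<longrightarrow>
        (- \<epsilon>) *\<^sub>R (LINT z|lebesgue. time_deriv \<phi> z *s v z)
        + (\<Sum>a\<in>Poly_Mapping.keys P. (- \<epsilon>) ^ (\<Sum>i\<in>UNIV. a i) *\<^sub>R
             (Poly_Mapping.lookup P a *v (LINT z|lebesgue. space_deriv a \<phi> z *s v z)))
        = (LINT z|lebesgue. \<phi> z *s f z))"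

section \<open>Banach spaces of functions\<close>

text \<open>The Banach space \<open>X\<close> is a type \<open>'x\<close> of class \<open>banach\<close> whose elements are identified with
  classes, modulo almost everywhere equality, of locally integrable functions from \<open>\<real>\<^sup>n\<close> to \<open>\<complex>\<^sup>q\<close>;
  \<open>J \<phi>\<close> is a representative of \<open>\<phi>\<close>.  The last condition is the standard requirement that the
  inclusion of \<open>X\<close> into \<open>L\<^sup>1\<^sub>l\<^sub>o\<^sub>c\<close> (equivalently, into the distributions) be continuous.  Only the real
  vector space structure of \<open>X\<close> is used.\<close>

definition function_space :: "('x::banach \<Rightarrow> real ^ 'n::finite \<Rightarrow> complex ^ 'q::finite) \<Rightarrow> bool" where
  "function_space J \<longleftrightarrow>
     (\<forall>\<phi>. locally_integrable (J \<phi>)) \<and>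
     (\<forall>\<phi> \<omega>. AE x in lebesgue. J (\<phi> + \<omega>) x = J \<phi> x + J \<omega> x) \<and>
     (\<forall>c \<phi>. AE x in lebesgue. J (c *\<^sub>R \<phi>) x = c *\<^sub>R J \<phi> x) \<and>
     (\<forall>\<phi>. (AE x in lebesgue. J \<phi> x = 0) \<longrightarrow> \<phi> = 0) \<and>
     (\<forall>K. compact K \<longrightarrow> (\<exists>C. \<forall>\<phi>. (LINT x:K|lebesgue. norm (J \<phi> x)) \<le> C * norm \<phi>))"

definition dilation_invariant :: "('x::banach \<Rightarrow> real ^ 'n::finite \<Rightarrow> complex ^ 'q::finite) \<Rightarrow> bool" where
  "dilation_invariant J \<longleftrightarrow>
     (\<forall>\<phi>. \<forall>\<mu>>0. \<exists>\<omega>. AE x in lebesgue. J \<omega> x = J \<phi> (\<mu> *\<^sub>R x))"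

text \<open>\<open>dilate J \<mu> \<phi>\<close> is \<open>\<phi>(\<mu> \<cdot>)\<close>, as an element of \<open>X\<close>.\<close>

definition dilate :: "('x::banach \<Rightarrow> real ^ 'n::finite \<Rightarrow> complex ^ 'q::finite) \<Rightarrow> real \<Rightarrow> 'x \<Rightarrow> 'x" where
  "dilate J \<mu> \<phi> = (THE \<omega>. AE x in lebesgue. J \<omega> x = J \<phi> (\<mu> *\<^sub>R x))"

definition norm_X_eps ::
    "('x::banach \<Rightarrow> real ^ 'n::finite \<Rightarrow> complex ^ 'q::finite) \<Rightarrow> real \<Rightarrow> real \<Rightarrow> 'x \<Rightarrow> real" where
  "norm_X_eps J \<alpha> \<epsilon> \<phi> = norm ((\<epsilon> powr \<alpha>) *\<^sub>R dilate J \<epsilon> \<phi>)"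

section \<open>Solutions\<close>

text \<open>\<open>u\<close> is a solution in \<open>C(\<real>; X)\<close> of \<open>\<epsilon> \<partial>\<^sub>t u + P(\<epsilon> \<partial>\<^sub>x) u = G(x, u)\<close>.  The representatives \<open>J (u t)\<close>
  are chosen for each \<open>t\<close> separately, so they need not be measurable in \<open>(t, x)\<close>; \<open>v\<close> is a
  representative of \<open>u\<close> that is.  It is unique up to a null set of \<open>\<real> \<times> \<real>\<^sup>n\<close>, and the conditions on it
  do not depend on the choice.\<close>

definition solution ::
    "('x::banach \<Rightarrow> real ^ 'n::finite \<Rightarrow> complex ^ 'q::finite) \<Rightarrow> ('n, 'q) matrix_poly \<Rightarrow> real \<Rightarrow>
      (real ^ 'n \<Rightarrow> complex ^ 'q \<Rightarrow> complex ^ 'q) \<Rightarrow> (real \<Rightarrow> 'x) \<Rightarrow> bool" where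
  "solution J P \<epsilon> G u \<longleftrightarrow>
     continuous_on UNIV u \<and>
     (\<exists>v. locally_integrable v \<and>
          (AE t in lebesgue. AE x in lebesgue. v (t, x) = J (u t) x) \<and>
          locally_integrable (\<lambda>(t, x). G x (v (t, x))) \<and>
          weak_equation P \<epsilon> v (\<lambda>(t, x). G x (v (t, x))))"

definition homogeneous :: "real \<Rightarrow> (real ^ 'n::finite \<Rightarrow> complex ^ 'q::finite \<Rightarrow> complex ^ 'q) \<Rightarrow> bool" where
  "homogeneous p F \<longleftrightarrow> (\<forall>x z. \<forall>\<mu>>0. F x (\<mu> *\<^sub>R z) = (\<mu> powr p) *\<^sub>R F x z)"

section \<open>The assumptions\<close>

definition assumption1a ::
    "('x::banach \<Rightarrow> real ^ 'n::finite \<Rightarrow> complex ^ 'q::finite) \<Rightarrow> ('n, 'q) matrix_poly \<Rightarrow>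
      (real \<Rightarrow> 'x \<Rightarrow> 'x) \<Rightarrow> bool" where
  "assumption1a J P U \<longleftrightarrow>
     (\<forall>\<phi>. \<exists>!\<psi>. solution J P 1 (\<lambda>x z. 0) \<psi> \<and> \<psi> 0 = \<phi>) \<and>
     (\<forall>t. linear (U t)) \<and>
     (\<forall>t \<phi>. norm (U t \<phi>) = norm \<phi>) \<and>
     U 0 = id \<and> (\<forall>s t. U (s + t) = U s \<circ> U t) \<and>
     (\<forall>\<phi> \<psi>. solution J P 1 (\<lambda>x z. 0) \<psi> \<and> \<psi> 0 = \<phi> \<longrightarrow> (\<forall>t. \<psi> t = U t \<phi>))"

definition decay_limsup ::
    "('x::banach \<Rightarrow> real ^ 'n::finite \<Rightarrow> complex ^ 'q::finite) \<Rightarrow> real \<Rightarrow> (real \<Rightarrow> 'x \<Rightarrow> 'x) \<Rightarrow>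
      real filter \<Rightarrow> 'x \<Rightarrow> ereal" where
  "decay_limsup J \<alpha> U net \<phi> =
     Limsup net (\<lambda>t. ereal (\<bar>t\<bar> powr \<alpha>) * esssup lebesgue (\<lambda>x. ereal (norm (J (U t \<phi>) x))))"

text \<open>\<open>U\<close> acts on \<open>X\<close>, so the Schwartz functions considered are those that belong to \<open>X\<close>.\<close>

definition schwartz_element :: "('x::banach \<Rightarrow> real ^ 'n::finite \<Rightarrow> complex ^ 'q::finite) \<Rightarrow> 'x \<Rightarrow> bool" where
  "schwartz_element J \<phi> \<longleftrightarrow> (\<exists>f. schwartz f \<and> (AE x in lebesgue. J \<phi> x = f x))"

definition assumption1b ::
    "('x::banach \<Rightarrow> real ^ 'n::finite \<Rightarrow> complex ^ 'q::finite) \<Rightarrow> real \<Rightarrow> (real \<Rightarrow> 'x \<Rightarrow> 'x) \<Rightarrow> bool" where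
  "assumption1b J \<alpha> U \<longleftrightarrow>
     \<alpha> \<ge> 0 \<and>
     (\<forall>\<phi>. schwartz_element J \<phi> \<longrightarrow>
        decay_limsup J \<alpha> U at_top \<phi> < \<infinity> \<and> decay_limsup J \<alpha> U at_bot \<phi> < \<infinity>) \<and>
     (\<exists>\<phi>. schwartz_element J \<phi> \<and> decay_limsup J \<alpha> U at_top \<phi> \<noteq> 0) \<and>
     (\<exists>\<phi>. schwartz_element J \<phi> \<and> decay_limsup J \<alpha> U at_bot \<phi> \<noteq> 0)"

definition assumption1c ::
    "real \<Rightarrow> (real \<Rightarrow> 'x::banach \<Rightarrow> 'x) \<Rightarrow> ('x \<Rightarrow> real \<Rightarrow> 'x) \<Rightarrow> ('x \<Rightarrow> real \<Rightarrow> 'x) \<Rightarrow> bool" where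
  "assumption1c \<alpha> U Aplus Aminus \<longleftrightarrow>
     (\<forall>\<phi>. continuous_on UNIV (Aplus \<phi>) \<and> continuous_on UNIV (Aminus \<phi>) \<and>
        ((\<lambda>t. norm (\<phi> - U (- t) ((\<bar>t\<bar> powr (- \<alpha>)) *\<^sub>R Aplus \<phi> t))) \<longlongrightarrow> 0) at_top \<and>
        ((\<lambda>t. norm (\<phi> - U (- t) ((\<bar>t\<bar> powr (- \<alpha>)) *\<^sub>R Aminus \<phi> t))) \<longlongrightarrow> 0) at_bot)"

text \<open>The condition that \<open>U(-t) \<psi>(t)\<close> equals \<open>\<psi>\<^sub>-\<close> at \<open>t = t\<^sub>0\<close>, read as a limit in \<open>X\<close> when \<open>t\<^sub>0 = -\<infinity>\<close>.\<close>

definition attains_data :: "(real \<Rightarrow> 'x::banach \<Rightarrow> 'x) \<Rightarrow> ereal \<Rightarrow> 'x \<Rightarrow> (real \<Rightarrow> 'x) \<Rightarrow> bool" where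
  "attains_data U t0 \<psi>m \<psi> \<longleftrightarrow>
     (if t0 = - \<infinity> then ((\<lambda>t. U (- t) (\<psi> t)) \<longlongrightarrow> \<psi>m) at_bot
      else U (- real_of_ereal t0) (\<psi> (real_of_ereal t0)) = \<psi>m)"

definition assumption4 ::
    "('x::banach \<Rightarrow> real ^ 'n::finite \<Rightarrow> complex ^ 'q::finite) \<Rightarrow> ('n, 'q) matrix_poly \<Rightarrow>
      (real ^ 'n \<Rightarrow> complex ^ 'q \<Rightarrow> complex ^ 'q) \<Rightarrow> (real \<Rightarrow> 'x \<Rightarrow> 'x) \<Rightarrow> bool" where
  "assumption4 J P F U \<longleftrightarrow>
     (\<exists>T::real. \<exists>\<eta>>0. \<exists>C::real \<Rightarrow> real. (C \<longlongrightarrow> 0) (at_right 0) \<and>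
        (\<forall>t0::ereal. \<forall>\<psi>m. t0 \<le> ereal (- T) \<and> norm \<psi>m < \<eta> \<longrightarrow>
           (\<exists>!\<psi>. solution J P 1 F \<psi> \<and> attains_data U t0 \<psi>m \<psi>) \<and>
           (\<forall>\<psi>. solution J P 1 F \<psi> \<and> attains_data U t0 \<psi>m \<psi> \<longrightarrow>
              (SUP t\<in>{t. t0 < ereal t}. ereal (norm (U (- t) (\<psi> t) - \<psi>m)))
                \<le> ereal (C (norm \<psi>m) * norm \<psi>m))))"

section \<open>The \<open>\<epsilon>\<close>-dependent problems\<close>

definition nonlinear_problem ::
    "('x::banach \<Rightarrow> real ^ 'n::finite \<Rightarrow> complex ^ 'q::finite) \<Rightarrow> ('n, 'q) matrix_poly \<Rightarrow>
      (real ^ 'n \<Rightarrow> complex ^ 'q \<Rightarrow> complex ^ 'q) \<Rightarrow> real \<Rightarrow> ('x \<Rightarrow> real \<Rightarrow> 'x) \<Rightarrow> 'x \<Rightarrow>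
      (real \<Rightarrow> 'x) \<Rightarrow> real \<Rightarrow> (real \<Rightarrow> 'x) \<Rightarrow> bool" where
  "nonlinear_problem J P F \<delta> Aminus \<psi>m r \<epsilon> u \<longleftrightarrow>
     solution J P \<epsilon> (\<lambda>x z. (\<epsilon> powr \<delta>) *\<^sub>R F ((1 / \<epsilon>) *\<^sub>R x) z) u \<and>
     u 0 = dilate J (1 / \<epsilon>) (Aminus \<psi>m (- 1 / \<epsilon>)) + r \<epsilon>"

definition linear_problem ::
    "('x::banach \<Rightarrow> real ^ 'n::finite \<Rightarrow> complex ^ 'q::finite) \<Rightarrow> ('n, 'q) matrix_poly \<Rightarrow>
      ('x \<Rightarrow> real \<Rightarrow> 'x) \<Rightarrow> 'x \<Rightarrow> real \<Rightarrow> (real \<Rightarrow> 'x) \<Rightarrow> bool" where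
  "linear_problem J P Aminus \<psi>m \<epsilon> w \<longleftrightarrow>
     solution J P \<epsilon> (\<lambda>x z. 0) w \<and>
     w 0 = dilate J (1 / \<epsilon>) (Aminus \<psi>m (- 1 / \<epsilon>))"

end

theory Submission
  imports Defs "HOL-Real_Asymp.Real_Asymp"
begin

text \<open>With \<open>\<beta> = \<delta> / (p - 1)\<close>, the substitution \<open>\<psi>(s, y) = \<epsilon>\<^sup>\<beta> u(1 + \<epsilon> s, \<epsilon> y)\<close> turns both
  \<open>\<epsilon>\<close>-dependent equations into their versions with \<open>\<epsilon> = 1\<close>: the operator scales exactly, and
  \<open>\<beta>\<close> is the exponent for which the homogeneity of \<open>F\<close> absorbs \<open>\<epsilon>\<^sup>\<delta>\<close> (\<open>solution_rescale_iff\<close>).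
  The initial time \<open>t = 0\<close> becomes \<open>s = -1/\<epsilon>\<close>, and the data of the rescaled nonlinear problem, pulled
  back along the group, are \<open>U(1/\<epsilon>) (\<epsilon>\<^sup>\<beta> (A\<^sub>- + r(\<epsilon> \<cdot>)))\<close>.

  By the description of \<open>A\<^sub>-\<close> at time \<open>-1/\<epsilon>\<close>, these data equal \<open>\<epsilon>\<close> to the power \<open>\<beta> - \<alpha>\<close> times a
  family converging to \<open>\<psi>\<^sub>-\<close>.  Since \<open>\<beta> > \<alpha>\<close> they tend to \<open>0\<close>, so for small \<open>\<epsilon>\<close> the small data theory
  of the fixed equation applies with \<open>t\<^sub>0 = -1/\<epsilon>\<close>: it gives the unique solution, and bounds its
  distance to the free evolution of its data by \<open>C(\<lambda>) \<lambda>\<close>, where \<open>\<lambda>\<close> is the norm of the data and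
  \<open>C(\<lambda>)\<close> tends to \<open>0\<close>.  In the norm \<open>norm_X_eps\<close> this distance is multiplied by \<open>\<epsilon>\<close> to the power
  \<open>\<alpha> - \<beta>\<close>, which keeps \<open>\<lambda>\<close> bounded and so leaves a quantity that tends to \<open>0\<close>.  The free
  evolutions of the two sets of data differ by that of \<open>r\<close>, whose norm is conserved and tends
  to \<open>0\<close> by assumption.

  The analytic content of the substitution is in \<open>solution_rescale\<close>.  A change of variables handles
  the weak formulation; continuity in time with values in \<open>X\<close> requires each dilation to be a bounded
  operator on \<open>X\<close>.  Invariance of \<open>X\<close> provides only a linear map, and boundedness follows from the
  closed graph theorem, the graph being closed because \<open>X\<close> embeds continuously into the locally
  integrable functions (\<open>bounded_linear_dilate\<close>).\<close>

section \<open>The closed graph theorem\<close>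

text \<open>By Baire's theorem, the closure of some \<open>{x. norm (f x) \<le> n}\<close> has interior points.  Hence every \<open>x\<close>
  is approximated, up to half its norm, by a vector whose image is controlled by \<open>norm x\<close>.  Iterating
  on the remainder writes \<open>x\<close> as a series whose images form an absolutely convergent series;
  closedness of the graph identifies the sum of the latter with \<open>f x\<close>.\<close>

lemma banach_closed_graph:
  fixes f :: "'a::banach \<Rightarrow> 'b::banach"
  assumes lin: "linear f"
    and closed_graph: "\<And>X y. X \<longlonglongrightarrow> 0 \<Longrightarrow> (\<lambda>n. f (X n)) \<longlonglongrightarrow> y \<Longrightarrow> y = 0"
  shows "bounded_linear f"
proof -
  define B where "B n = {x. norm (f x) \<le> real n}" for n :: nat
  have "(\<Union>n. closure (B n)) = UNIV"
  proof -
    have "x \<in> (\<Union>n. closure (B n))" for x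
    proof -
      obtain n :: nat where "norm (f x) \<le> real n"
        using real_arch_simple by blast
      then show ?thesis
        using closure_subset[of "B n"] by (auto simp: B_def)
    qed
    then show ?thesis by blast
  qed
  moreover have "interior (\<Union>n. closure (B n)) = {}" if "\<And>n. interior (closure (B n)) = {}"
  proof -
    have "euclidean interior_of \<Union>(range (\<lambda>n. closure (B n))) = {}"
      using that by (intro Baire_category_alt) (auto simp: completely_metrizable_space_euclidean)
    then show ?thesis by simp
  qed
  ultimately obtain n where n: "interior (closure (B n)) \<noteq> {}"
    by auto
  then obtain x0 e where e: "e > 0" and ball: "ball x0 e \<subseteq> closure (B n)"
    by (metis equals0I mem_interior)
  \<comment> \<open>A point of norm \<open>e / 2\<close> is a difference of two points of the ball around \<open>x0\<close>, each within \<open>e / 8\<close>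
    of \<open>B n\<close>; this gives an error of \<open>e / 4\<close>, half of the norm, and an image of norm at most \<open>2 n\<close>.\<close>
  define K where "K = 4 * real n / e"
  have half: "\<exists>y. norm (f y) \<le> K * norm x \<and> norm (x - y) \<le> norm x / 2" for x
  proof (cases "x = 0")
    case True
    then show ?thesis by (intro exI[of _ 0]) (simp add: linear_0[OF lin])
  next
    case False
    define c where "c = e / (2 * norm x)"
    have c: "c > 0" using False e by (simp add: c_def)
    have ncx: "norm (c *\<^sub>R x) = e / 2" using False e by (simp add: c_def)
    have approx: "\<exists>y\<in>B n. dist y z < e / 8" if "z \<in> ball x0 e" for z
      using ball that e closure_approachable[of z "B n"] by (metis divide_pos_pos subsetD zero_less_numeral)
    have "x0 + c *\<^sub>R x \<in> ball x0 e" using ncx e by (simp add: dist_norm)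
    then obtain y1 where y1: "y1 \<in> B n" "dist y1 (x0 + c *\<^sub>R x) < e / 8" using approx by blast
    have "x0 \<in> ball x0 e" using e by simp
    then obtain y2 where y2: "y2 \<in> B n" "dist y2 x0 < e / 8" using approx by blast
    define y where "y = (1 / c) *\<^sub>R (y1 - y2)"
    have "norm (f y) = (1 / c) * norm (f y1 - f y2)"
      using c by (simp add: y_def linear_scale[OF lin] linear_diff[OF lin])
    also have "\<dots> \<le> (1 / c) * (2 * real n)"
      using y1(1) y2(1) norm_triangle_ineq4[of "f y1" "f y2"] c
      by (intro mult_left_mono) (auto simp: B_def)
    also have "\<dots> = K * norm x" using e False by (simp add: K_def c_def field_simps)
    finally have 1: "norm (f y) \<le> K * norm x" .
    have "norm (c *\<^sub>R (x - y)) = norm ((x0 + c *\<^sub>R x - y1) + (y2 - x0))"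
      using c by (simp add: y_def scaleR_diff_right algebra_simps)
    also have "\<dots> \<le> e / 4"
      using y1(2) y2(2) norm_triangle_ineq[of "x0 + c *\<^sub>R x - y1" "y2 - x0"]
      by (simp add: dist_norm norm_minus_commute)
    finally have "c * norm (x - y) \<le> e / 4" using c by simp
    then have "norm (x - y) \<le> norm x / 2"
      using c e False by (simp add: c_def field_simps)
    with 1 show ?thesis by blast
  qed
  then obtain h where h: "\<And>x. norm (f (h x)) \<le> K * norm x" "\<And>x. norm (x - h x) \<le> norm x / 2"
    by metis
  have K0: "K \<ge> 0" using e by (simp add: K_def)
  have "norm (f x) \<le> norm x * (2 * K)" for x
  proof -
    \<comment> \<open>\<open>R k\<close> is what remains of \<open>x\<close> after \<open>k\<close> approximation steps.\<close>
    define R where "R k = ((\<lambda>z. z - h z) ^^ k) x" for k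
    have R_Suc: "R (Suc k) = R k - h (R k)" for k by (simp add: R_def)
    have R_le: "norm (R k) \<le> (1 / 2) ^ k * norm x" for k
    proof (induction k)
      case (Suc k)
      have "norm (R (Suc k)) \<le> norm (R k) / 2" using h(2) by (simp add: R_Suc)
      also have "\<dots> \<le> (1 / 2) ^ Suc k * norm x" using Suc by simp
      finally show ?case .
    qed (simp add: R_def)
    have fh: "norm (f (h (R k))) \<le> (K * norm x) * (1 / 2) ^ k" for k
      using h(1)[of "R k"] mult_left_mono[OF R_le[of k] K0] by (simp add: mult_ac)
    have geo: "summable (\<lambda>k. (K * norm x) * (1 / 2 :: real) ^ k)"
      by (intro summable_mult summable_geometric) simp
    have summ: "summable (\<lambda>k. f (h (R k)))"
      by (rule summable_comparison_test'[OF geo]) (use fh in auto)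
    have tele: "(\<Sum>k<m. h (R k)) = x - R m" for m
      by (induction m) (auto simp: R_Suc, simp add: R_def)
    have f_sum: "(\<Sum>k<m. f (h (R k))) = f x - f (R m)" for m
      by (simp add: tele linear_diff[OF lin] flip: linear_sum[OF lin])
    have "(\<lambda>k. (1 / 2) ^ k * norm x) \<longlonglongrightarrow> 0"
      by (auto intro!: tendsto_mult_left_zero LIMSEQ_power_zero)
    then have R0: "R \<longlonglongrightarrow> 0"
      by (rule Lim_null_comparison[rotated]) (use R_le in auto)
    have "(\<lambda>m. f x - (\<Sum>k<m. f (h (R k)))) \<longlonglongrightarrow> f x - suminf (\<lambda>k. f (h (R k)))"
      by (intro tendsto_diff tendsto_const summable_LIMSEQ summ)
    then have lim: "(\<lambda>m. f (R m)) \<longlonglongrightarrow> f x - suminf (\<lambda>k. f (h (R k)))"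
      by (simp add: f_sum)
    then have "f x = suminf (\<lambda>k. f (h (R k)))"
      using closed_graph[OF R0 lim] by simp
    also have "norm \<dots> \<le> suminf (\<lambda>k. (K * norm x) * (1 / 2) ^ k)"
      by (rule norm_suminf_le[OF fh geo])
    also have "\<dots> = norm x * (2 * K)"
      by (subst suminf_mult) (auto simp: suminf_geometric summable_geometric)
    finally show ?thesis .
  qed
  then show ?thesis
    using lin by (auto simp: bounded_linear_def bounded_linear_axioms_def)
qed

section \<open>Affine changes of variables\<close>

lemma
  fixes t :: "'a::euclidean_space"
  assumes "c \<noteq> 0"
  shows lebesgue_scaleR_affine:
      "lebesgue = density (distr lebesgue lebesgue (\<lambda>x. t + c *\<^sub>R x)) (\<lambda>_. ennreal (\<bar>c\<bar> ^ DIM('a)))"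
    and measurable_lebesgue_scaleR_affine: "(\<lambda>x. t + c *\<^sub>R x) \<in> lebesgue \<rightarrow>\<^sub>M lebesgue"
  using lebesgue_affine_euclidean[where c = "\<lambda>_::'a. c" and t = t]
    lebesgue_affine_measurable[where c = "\<lambda>_::'a. c" and t = t] assms
  unfolding scaleR_scaleR[symmetric] scaleR_sum_right[symmetric] euclidean_representation prod_constant
  by simp_all

lemma AE_lebesgue_scaleR_affine:
  fixes t :: "'a::euclidean_space"
  assumes c: "c \<noteq> 0" and "AE x in lebesgue. Q x"
  shows "AE x in lebesgue. Q (t + c *\<^sub>R x)"
proof -
  have "AE x in density (distr lebesgue lebesgue (\<lambda>x. t + c *\<^sub>R x)) (\<lambda>_. ennreal (\<bar>c\<bar> ^ DIM('a))). Q x"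
    using assms(2) by (simp only: lebesgue_scaleR_affine[OF c, of t, symmetric])
  then have "AE x in distr lebesgue lebesgue (\<lambda>x. t + c *\<^sub>R x). Q x"
    using c by (simp add: AE_density)
  then show ?thesis
    by (rule AE_distrD[OF measurable_lebesgue_scaleR_affine[OF c]])
qed

lemma
  fixes f :: "'a::euclidean_space \<Rightarrow> 'b::euclidean_space"
  assumes c: "c \<noteq> 0"
  shows integrable_lebesgue_scaleR_affine_iff:
      "integrable lebesgue (\<lambda>x. f (t + c *\<^sub>R x)) \<longleftrightarrow> integrable lebesgue f" (is ?I)
    and integral_lebesgue_scaleR_affine:
      "(LINT x|lebesgue. f x) = \<bar>c\<bar> ^ DIM('a) *\<^sub>R (LINT x|lebesgue. f (t + c *\<^sub>R x))" (is ?E)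
proof -
  have fwd: "integrable lebesgue (\<lambda>x. g (s + d *\<^sub>R x))"
    if "integrable lebesgue g" "d \<noteq> 0" for g :: "'a \<Rightarrow> 'b" and s d
  proof -
    have "integrable (density (distr lebesgue lebesgue (\<lambda>x. s + d *\<^sub>R x)) (\<lambda>_. ennreal (\<bar>d\<bar> ^ DIM('a)))) g"
      using that(1) by (simp only: lebesgue_scaleR_affine[OF that(2), of s, symmetric])
    then have "integrable (distr lebesgue lebesgue (\<lambda>x. s + d *\<^sub>R x)) (\<lambda>x. (\<bar>d\<bar> ^ DIM('a)) *\<^sub>R g x)"
      using that by (subst (asm) integrable_density) auto
    from integrable_scaleR_right[OF this, of "1 / \<bar>d\<bar> ^ DIM('a)"]
    have "integrable (distr lebesgue lebesgue (\<lambda>x. s + d *\<^sub>R x)) g"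
      using that(2) by simp
    then show ?thesis
      by (rule integrable_distr[OF measurable_lebesgue_scaleR_affine[OF that(2)]])
  qed
  show iff: ?I
    using fwd[of f c t] fwd[of "\<lambda>x. f (t + c *\<^sub>R x)" "1 / c" "(- 1 / c) *\<^sub>R t"] c
    by (auto simp: scaleR_add_right scaleR_diff_right)
  show ?E
  proof (cases "integrable lebesgue f")
    case True
    then show ?thesis
      using measurable_lebesgue_scaleR_affine[OF c, of t]
      by (subst lebesgue_scaleR_affine[OF c, of t]) (auto simp: integral_density integral_distr)
  next
    case False
    with iff show ?thesis by (simp add: not_integrable_integral_eq)
  qed
qed

lemma locally_integrable_scaleR_affine:
  fixes f :: "'a::euclidean_space \<Rightarrow> 'b::euclidean_space"
  assumes "locally_integrable f" and c: "c \<noteq> 0"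
  shows "locally_integrable (\<lambda>x. f (t + c *\<^sub>R x))"
  unfolding locally_integrable_def set_integrable_def
proof (intro allI impI)
  fix K :: "'a set" assume "compact K"
  define L where "L = (\<lambda>x. t + c *\<^sub>R x) ` K"
  have "compact L"
    unfolding L_def using \<open>compact K\<close> by (intro compact_continuous_image continuous_intros)
  then have "integrable lebesgue (\<lambda>x. indicator L x *\<^sub>R f x)"
    using assms(1) by (auto simp: locally_integrable_def set_integrable_def)
  then have "integrable lebesgue (\<lambda>x. indicator L (t + c *\<^sub>R x) *\<^sub>R f (t + c *\<^sub>R x))"
    using integrable_lebesgue_scaleR_affine_iff[OF c, of "\<lambda>x. indicator L x *\<^sub>R f x" t] by simp
  moreover have "indicator L (t + c *\<^sub>R x) = (indicator K x :: real)" for x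
    using c by (auto simp: L_def indicator_def)
  ultimately show "integrable lebesgue (\<lambda>x. indicator K x *\<^sub>R f (t + c *\<^sub>R x))" by simp
qed

lemma locally_integrable_scaleR:
  fixes f :: "'a::euclidean_space \<Rightarrow> 'b::euclidean_space"
  shows "locally_integrable f \<Longrightarrow> locally_integrable (\<lambda>x. c *\<^sub>R f x)"
  by (simp add: locally_integrable_def)

lemma deriv_along_scaleR_affine:
  assumes "f differentiable_on UNIV"
  shows "deriv_along v (\<lambda>x. k *\<^sub>R f (t + c *\<^sub>R x)) = (\<lambda>x. (k * c) *\<^sub>R deriv_along v f (t + c *\<^sub>R x))"
proof
  fix x
  let ?D = "frechet_derivative f (at (t + c *\<^sub>R x))"
  have D: "(f has_derivative ?D) (at (t + c *\<^sub>R x))"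
    using assms by (simp add: differentiable_on_def frechet_derivative_works)
  have "((\<lambda>x. t + c *\<^sub>R x) has_derivative (\<lambda>h. c *\<^sub>R h)) (at x)"
    by (auto intro!: derivative_eq_intros)
  from has_derivative_compose[OF this D]
  have "((\<lambda>x. k *\<^sub>R f (t + c *\<^sub>R x)) has_derivative (\<lambda>h. k *\<^sub>R ?D (c *\<^sub>R h))) (at x)"
    by (rule has_derivative_scaleR_right)
  then have "frechet_derivative (\<lambda>x. k *\<^sub>R f (t + c *\<^sub>R x)) (at x) = (\<lambda>h. k *\<^sub>R ?D (c *\<^sub>R h))"
    by (rule frechet_derivative_at[symmetric])
  then show "deriv_along v (\<lambda>x. k *\<^sub>R f (t + c *\<^sub>R x)) x = (k * c) *\<^sub>R deriv_along v f (t + c *\<^sub>R x)"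
    using linear_frechet_derivative[OF differentiableI[OF D]]
    by (simp add: deriv_along_def linear_scale)
qed

text \<open>Differentiability of the inner derivatives is essential: at a point where a function is not
  differentiable, its Frechet derivative is an unspecified map, and no chain rule can be expected.\<close>

lemma iterated_deriv_scaleR_affine:
  assumes "smooth f" and "set vs \<subseteq> Basis"
  shows "iterated_deriv vs (\<lambda>x. f (t + c *\<^sub>R x)) =
    (\<lambda>x. c ^ length vs *\<^sub>R iterated_deriv vs f (t + c *\<^sub>R x))"
  using assms(2)
proof (induction vs)
  case Nil
  then show ?case by (simp add: iterated_deriv_def)
next
  case (Cons v vs)
  then have "iterated_deriv vs f differentiable_on UNIV"
    using assms(1) by (simp add: smooth_def)
  with Cons show ?case
    by (simp add: iterated_deriv_def deriv_along_scaleR_affine mult.commute)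
qed

lemma smooth_scaleR_affine:
  assumes "smooth f"
  shows "smooth (\<lambda>x. f (t + c *\<^sub>R x))"
  unfolding smooth_def
proof (intro allI impI)
  fix vs :: "'a list" assume vs: "set vs \<subseteq> Basis"
  then have "iterated_deriv vs f differentiable_on UNIV"
    using assms by (simp add: smooth_def)
  then have "(iterated_deriv vs f \<circ> (\<lambda>x. t + c *\<^sub>R x)) differentiable_on UNIV"
    by (auto simp: differentiable_on_def intro!: differentiable_chain_at)
  then show "iterated_deriv vs (\<lambda>x. f (t + c *\<^sub>R x)) differentiable_on UNIV"
    unfolding iterated_deriv_scaleR_affine[OF assms vs]
    by (auto simp: o_def differentiable_on_def intro: differentiable_scaleR)
qed

lemma test_function_scaleR_affine:
  assumes "test_function \<phi>" and c: "c \<noteq> 0"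
  shows "test_function (\<lambda>x. \<phi> (t + c *\<^sub>R x))"
proof -
  have "bounded ((\<lambda>x. (1 / c) *\<^sub>R x) ` (\<lambda>x. - t + x) ` {z. \<phi> z \<noteq> 0})"
    using assms(1) unfolding test_function_def compact_closure
    by (intro bounded_scaling bounded_translation) auto
  moreover have "{x. \<phi> (t + c *\<^sub>R x) \<noteq> 0} \<subseteq> (\<lambda>x. (1 / c) *\<^sub>R x) ` (\<lambda>x. - t + x) ` {z. \<phi> z \<noteq> 0}"
    using c by (auto simp: image_iff intro!: exI[of _ "t + c *\<^sub>R _"] bexI[of _ "c *\<^sub>R _"])
  ultimately have "bounded {x. \<phi> (t + c *\<^sub>R x) \<noteq> 0}"
    by (rule bounded_subset)
  then show ?thesis
    using assms(1) by (simp add: test_function_def compact_closure smooth_scaleR_affine)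
qed

lemma exists_list_count:
  fixes a :: "'n::finite \<Rightarrow> nat"
  shows "\<exists>l. \<forall>i. count_list l i = a i"
proof -
  obtain m where "\<forall>i. count (m :: 'n multiset) i = a i"
    by (rule exI[THEN exE, of "\<lambda>m. \<forall>i. count m i = a i" "Abs_multiset a"]) (auto simp: Abs_multiset_inverse)
  then show ?thesis by (metis count_mset ex_mset)
qed

lemma space_deriv_scaleR_affine:
  fixes \<phi> :: "real \<times> (real ^ 'n::finite) \<Rightarrow> complex"
  assumes "smooth \<phi>"
  shows "space_deriv a (\<lambda>z. \<phi> (t + c *\<^sub>R z)) = (\<lambda>z. c ^ (\<Sum>i\<in>UNIV. a i) *\<^sub>R space_deriv a \<phi> (t + c *\<^sub>R z))"
proof -
  define l where "l = (SOME l. \<forall>i. count_list l i = a i)"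
  have l: "count_list l i = a i" for i
    using someI_ex[OF exists_list_count[of a]] by (simp add: l_def)
  have "length l = (\<Sum>i\<in>UNIV. a i)"
    using sum_count_set[of l UNIV] by (simp add: l)
  moreover have "set (map (\<lambda>i. (0 :: real, axis i (1 :: real))) l) \<subseteq> Basis"
    by (auto simp: Basis_prod_def axis_in_Basis_iff)
  ultimately show ?thesis
    using iterated_deriv_scaleR_affine[OF assms, of "map (\<lambda>i. (0, axis i 1)) l" t c]
    by (simp add: space_deriv_def flip: l_def)
qed

lemma time_deriv_scaleR_affine:
  fixes \<phi> :: "real \<times> (real ^ 'n::finite) \<Rightarrow> complex"
  assumes "smooth \<phi>"
  shows "time_deriv (\<lambda>z. \<phi> (t + c *\<^sub>R z)) = (\<lambda>z. c *\<^sub>R time_deriv \<phi> (t + c *\<^sub>R z))"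
  using iterated_deriv_scaleR_affine[OF assms, of "[(1, 0)]" t c]
  by (simp add: time_deriv_def iterated_deriv_def Basis_prod_def)

section \<open>Dilations\<close>

lemma matrix_vector_mult_scaleR:
  fixes A :: "complex ^ 'q::finite ^ 'q"
  shows "A *v (k *\<^sub>R x) = k *\<^sub>R (A *v x)"
  by (simp add: vec_eq_iff matrix_vector_mult_def scaleR_sum_right)

lemma vector_scalar_mult_scaleR:
  fixes x :: "complex ^ 'q::finite"
  shows "(k *\<^sub>R c) *s x = k *\<^sub>R (c *s x)" and "c *s (k *\<^sub>R x) = k *\<^sub>R (c *s x)"
  by (simp_all add: vec_eq_iff)

context
  fixes J :: "'x::banach \<Rightarrow> real ^ 'n::finite \<Rightarrow> complex ^ 'q::finite"
  assumes function_space: "function_space J" and dilation_invariant: "dilation_invariant J"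
begin

lemma representative_add: "AE x in lebesgue. J (\<phi> + \<omega>) x = J \<phi> x + J \<omega> x"
  and representative_scaleR: "AE x in lebesgue. J (c *\<^sub>R \<phi>) x = c *\<^sub>R J \<phi> x"
  and representative_eq_0: "(AE x in lebesgue. J \<phi> x = 0) \<Longrightarrow> \<phi> = 0"
  and locally_integrable_representative: "locally_integrable (J \<phi>)"
  and representative_L1_bound: "compact K \<Longrightarrow>
    \<exists>C. \<forall>\<phi>. (LINT x|lebesgue. indicator K x *\<^sub>R norm (J \<phi> x)) \<le> C * norm \<phi>"
  using function_space by (simp_all add: function_space_def set_lebesgue_integral_def)

lemma representative_diff: "AE x in lebesgue. J (\<phi> - \<omega>) x = J \<phi> x - J \<omega> x"
  using representative_add[of \<phi> "(- 1) *\<^sub>R \<omega>"] representative_scaleR[of "- 1" \<omega>]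
  by eventually_elim simp

lemma representative_inject: "(AE x in lebesgue. J \<phi> x = J \<omega> x) \<Longrightarrow> \<phi> = \<omega>"
  using representative_eq_0[of "\<phi> - \<omega>"] eventually_elim2[OF _ representative_diff[of \<phi> \<omega>]]
  by force

lemma dilate_eqI:
  assumes "AE x in lebesgue. J \<omega> x = J \<phi> (\<mu> *\<^sub>R x)"
  shows "dilate J \<mu> \<phi> = \<omega>"
  unfolding dilate_def
proof (rule the_equality)
  fix \<omega>' assume "AE x in lebesgue. J \<omega>' x = J \<phi> (\<mu> *\<^sub>R x)"
  with assms have "AE x in lebesgue. J \<omega>' x = J \<omega> x"
    by eventually_elim simp
  then show "\<omega>' = \<omega>" by (rule representative_inject)
qed (fact assms)

lemma representative_dilate:
  assumes "\<mu> > 0"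
  shows "AE x in lebesgue. J (dilate J \<mu> \<phi>) x = J \<phi> (\<mu> *\<^sub>R x)"
proof -
  obtain \<omega> where \<omega>: "AE x in lebesgue. J \<omega> x = J \<phi> (\<mu> *\<^sub>R x)"
    using dilation_invariant assms unfolding dilation_invariant_def by blast
  show ?thesis using \<omega> unfolding dilate_eqI[OF \<omega>] .
qed

lemma dilate_1: "dilate J 1 \<phi> = \<phi>"
  by (rule dilate_eqI) simp

lemma dilate_dilate:
  assumes "\<mu> > 0" "\<nu> > 0"
  shows "dilate J \<mu> (dilate J \<nu> \<phi>) = dilate J (\<nu> * \<mu>) \<phi>"
proof (rule dilate_eqI)
  have "AE x in lebesgue. J (dilate J \<nu> \<phi>) (0 + \<mu> *\<^sub>R x) = J \<phi> (\<nu> *\<^sub>R (0 + \<mu> *\<^sub>R x))"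
    by (rule AE_lebesgue_scaleR_affine) (use assms representative_dilate in auto)
  with representative_dilate[of "\<nu> * \<mu>" \<phi>] assms
  show "AE x in lebesgue. J (dilate J (\<nu> * \<mu>) \<phi>) x = J (dilate J \<nu> \<phi>) (\<mu> *\<^sub>R x)"
    by auto
qed

lemma linear_dilate:
  assumes "\<mu> > 0"
  shows "linear (dilate J \<mu>)"
proof (rule linearI)
  fix \<phi> \<omega>
  have "AE x in lebesgue. J (\<phi> + \<omega>) (0 + \<mu> *\<^sub>R x) = J \<phi> (0 + \<mu> *\<^sub>R x) + J \<omega> (0 + \<mu> *\<^sub>R x)"
    by (rule AE_lebesgue_scaleR_affine) (use assms representative_add in auto)
  with representative_dilate[OF assms, of \<phi>] representative_dilate[OF assms, of \<omega>]
    representative_add[of "dilate J \<mu> \<phi>" "dilate J \<mu> \<omega>"]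
  have "AE x in lebesgue. J (dilate J \<mu> \<phi> + dilate J \<mu> \<omega>) x = J (\<phi> + \<omega>) (\<mu> *\<^sub>R x)"
    by eventually_elim simp
  then show "dilate J \<mu> (\<phi> + \<omega>) = dilate J \<mu> \<phi> + dilate J \<mu> \<omega>"
    by (rule dilate_eqI)
next
  fix c \<phi>
  have "AE x in lebesgue. J (c *\<^sub>R \<phi>) (0 + \<mu> *\<^sub>R x) = c *\<^sub>R J \<phi> (0 + \<mu> *\<^sub>R x)"
    by (rule AE_lebesgue_scaleR_affine) (use assms representative_scaleR in auto)
  with representative_dilate[OF assms, of \<phi>] representative_scaleR[of c "dilate J \<mu> \<phi>"]
  have "AE x in lebesgue. J (c *\<^sub>R dilate J \<mu> \<phi>) x = J (c *\<^sub>R \<phi>) (\<mu> *\<^sub>R x)"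
    by eventually_elim simp
  then show "dilate J \<mu> (c *\<^sub>R \<phi>) = c *\<^sub>R dilate J \<mu> \<phi>"
    by (rule dilate_eqI)
qed

lemma integrable_indicator_norm_representative:
  "compact K \<Longrightarrow> integrable lebesgue (\<lambda>x. indicator K x *\<^sub>R norm (J \<phi> x))"
  using locally_integrable_representative[of \<phi>, unfolded locally_integrable_def]
    set_integrable_norm[of lebesgue K "J \<phi>"]
  by (auto simp: set_integrable_def)

text \<open>Suppose \<open>X n\<close> tends to \<open>0\<close> and its dilates tend to \<open>y\<close> in \<open>X\<close>.  On a ball \<open>K\<close> the \<open>L\<^sup>1\<close> norm of the
  dilates is, up to a constant, that of \<open>X n\<close> on the dilated ball \<open>L\<close>, so it tends to \<open>0\<close>; it also
  tends to that of \<open>y\<close>.  Hence \<open>y\<close> vanishes almost everywhere on every ball, and the graph is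
  closed.\<close>

lemma bounded_linear_dilate:
  assumes \<mu>: "\<mu> > 0"
  shows "bounded_linear (dilate J \<mu>)"
proof (rule banach_closed_graph[OF linear_dilate[OF \<mu>]])
  fix X y
  assume X: "X \<longlonglongrightarrow> 0" and DX: "(\<lambda>n. dilate J \<mu> (X n)) \<longlonglongrightarrow> y"
  have "AE x in lebesgue. x \<in> cball 0 (real m) \<longrightarrow> J y x = 0" for m
  proof -
    define K where "K = cball (0 :: real ^ 'n) (real m)"
    define L where "L = cball (0 :: real ^ 'n) (\<mu> * real m)"
    have K: "compact K" and L: "compact L" by (simp_all add: K_def L_def)
    obtain C where C: "\<And>\<phi>. (LINT x|lebesgue. indicator K x *\<^sub>R norm (J \<phi> x)) \<le> C * norm \<phi>"
      using representative_L1_bound[OF K] by blast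
    obtain C' where C': "\<And>\<phi>. (LINT x|lebesgue. indicator L x *\<^sub>R norm (J \<phi> x)) \<le> C' * norm \<phi>"
      using representative_L1_bound[OF L] by blast
    let ?d = "\<bar>\<mu>\<bar> ^ DIM(real ^ 'n)"
    have ind: "indicator L (0 + \<mu> *\<^sub>R x) = (indicator K x :: real)" for x
      using \<mu> by (simp add: K_def L_def indicator_def)
    have dil: "(LINT x|lebesgue. indicator K x *\<^sub>R norm (J (dilate J \<mu> \<phi>) x)) \<le> C' / ?d * norm \<phi>" for \<phi>
    proof -
      have "(LINT x|lebesgue. indicator K x *\<^sub>R norm (J (dilate J \<mu> \<phi>) x))
          = (LINT x|lebesgue. indicator L (0 + \<mu> *\<^sub>R x) *\<^sub>R norm (J \<phi> (0 + \<mu> *\<^sub>R x)))"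
      proof (rule integral_cong_AE)
        show "(\<lambda>x. indicator K x *\<^sub>R norm (J (dilate J \<mu> \<phi>) x)) \<in> borel_measurable lebesgue"
          using integrable_indicator_norm_representative[OF K] by blast
        show "(\<lambda>x. indicator L (0 + \<mu> *\<^sub>R x) *\<^sub>R norm (J \<phi> (0 + \<mu> *\<^sub>R x))) \<in> borel_measurable lebesgue"
          using integrable_indicator_norm_representative[OF L, of \<phi>]
            integrable_lebesgue_scaleR_affine_iff[of \<mu> "\<lambda>x. indicator L x *\<^sub>R norm (J \<phi> x)" 0] \<mu>
          by (intro borel_measurable_integrable) auto
        show "AE x in lebesgue. indicator K x *\<^sub>R norm (J (dilate J \<mu> \<phi>) x)
            = indicator L (0 + \<mu> *\<^sub>R x) *\<^sub>R norm (J \<phi> (0 + \<mu> *\<^sub>R x))"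
          using representative_dilate[OF \<mu>, of \<phi>] unfolding ind by eventually_elim simp
      qed
      also have "?d * \<dots> = (LINT x|lebesgue. indicator L x *\<^sub>R norm (J \<phi> x))"
        using integral_lebesgue_scaleR_affine[of \<mu> "\<lambda>x. indicator L x *\<^sub>R norm (J \<phi> x)" 0] \<mu> by simp
      finally show ?thesis using C'[of \<phi>] \<mu> by (simp add: field_simps)
    qed
    have bound: "(LINT x|lebesgue. indicator K x *\<^sub>R norm (J y x))
        \<le> C * norm (y - dilate J \<mu> (X n)) + C' / ?d * norm (X n)" for n
    proof -
      let ?D = "dilate J \<mu> (X n)"
      have "(LINT x|lebesgue. indicator K x *\<^sub>R norm (J y x))
          \<le> (LINT x|lebesgue. indicator K x *\<^sub>R norm (J (y - ?D) x) + indicator K x *\<^sub>R norm (J ?D x))"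
      proof (rule integral_mono_AE)
        show "AE x in lebesgue. indicator K x *\<^sub>R norm (J y x)
            \<le> indicator K x *\<^sub>R norm (J (y - ?D) x) + indicator K x *\<^sub>R norm (J ?D x)"
          using representative_diff[of y ?D]
        proof eventually_elim
          case (elim x)
          then show ?case
            using norm_triangle_ineq[of "J y x - J ?D x" "J ?D x"] by (simp add: indicator_def)
        qed
      qed (intro Bochner_Integration.integrable_add integrable_indicator_norm_representative K)+
      also have "\<dots> = (LINT x|lebesgue. indicator K x *\<^sub>R norm (J (y - ?D) x))
          + (LINT x|lebesgue. indicator K x *\<^sub>R norm (J ?D x))"
        by (intro Bochner_Integration.integral_add integrable_indicator_norm_representative K)
      finally show ?thesis using C[of "y - ?D"] dil[of "X n"] by linarith
    qed
    have "(\<lambda>n. C * norm (y - dilate J \<mu> (X n)) + C' / ?d * norm (X n)) \<longlonglongrightarrow> C * norm (y - y) + C' / ?d * norm (0 :: 'x)"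
      by (intro tendsto_intros X DX)
    then have "(LINT x|lebesgue. indicator K x *\<^sub>R norm (J y x)) \<le> 0"
      using bound by (intro LIMSEQ_le_const) auto
    moreover have "(LINT x|lebesgue. indicator K x *\<^sub>R norm (J y x)) \<ge> 0"
      by (intro integral_nonneg_AE) auto
    ultimately have "(LINT x|lebesgue. indicator K x *\<^sub>R norm (J y x)) = 0"
      by (rule antisym)
    then have "AE x in lebesgue. indicator K x *\<^sub>R norm (J y x) = 0"
      using integral_nonneg_eq_0_iff_AE[OF integrable_indicator_norm_representative[OF K, of y]] by simp
    then show ?thesis
      by eventually_elim (auto simp: K_def)
  qed
  then have "AE x in lebesgue. \<forall>m. x \<in> cball 0 (real m) \<longrightarrow> J y x = 0"
    unfolding AE_all_countable by blast
  then have "AE x in lebesgue. J y x = 0"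
  proof eventually_elim
    case (elim x)
    obtain m :: nat where "norm x \<le> real m"
      using real_arch_simple by blast
    with elim show ?case by auto
  qed
  then show "y = 0" by (rule representative_eq_0)
qed

section \<open>Rescaling solutions\<close>

text \<open>Space and time are dilated by the same factor, so the substitution is the composition with the
  affine map \<open>z \<mapsto> (a, 0) + \<mu> z\<close> of space-time.  The weak equation for the new function, tested
  against \<open>\<phi>\<close>, is the old one tested against \<open>\<phi>\<close> composed with the inverse map: every derivative of
  order \<open>k\<close> contributes \<open>(1 / \<mu>)\<^sup>k\<close>, which changes \<open>\<epsilon>\<close> into \<open>\<epsilon> / \<mu>\<close>, while the Jacobian \<open>d\<close> is common to all
  terms and cancels.\<close>

lemma solution_rescale:
  assumes \<mu>: "\<mu> > 0"
    and G': "\<And>y z. G' y (c *\<^sub>R z) = c *\<^sub>R G (\<mu> *\<^sub>R y) z"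
    and sol: "solution J P \<epsilon> G u"
  shows "solution J P (\<epsilon> / \<mu>) G' (\<lambda>s. c *\<^sub>R dilate J \<mu> (u (a + \<mu> * s)))"
proof -
  from sol obtain v where cont: "continuous_on UNIV u"
    and v: "locally_integrable v"
    and vJ: "AE t in lebesgue. AE x in lebesgue. v (t, x) = J (u t) x"
    and Gv: "locally_integrable (\<lambda>(t, x). G x (v (t, x)))"
    and weak: "weak_equation P \<epsilon> v (\<lambda>(t, x). G x (v (t, x)))"
    unfolding solution_def by (elim exE conjE) (rule that)
  define b where "b = (a, 0 :: real ^ 'n)"
  define T where "T = (\<lambda>z :: real \<times> (real ^ 'n). b + \<mu> *\<^sub>R z)"
  define S where "S = (\<lambda>z :: real \<times> (real ^ 'n). - (1 / \<mu>) *\<^sub>R b + (1 / \<mu>) *\<^sub>R z)"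
  have T_Pair: "T (s, y) = (a + \<mu> * s, \<mu> *\<^sub>R y)" for s y
    by (simp add: T_def b_def)
  have ST: "S (T z) = z" for z
    using \<mu> by (simp add: S_def T_def scaleR_add_right)
  define v' where "v' = (\<lambda>z. c *\<^sub>R v (T z))"
  have G'v': "(\<lambda>(s, y). G' y (v' (s, y))) = (\<lambda>z. c *\<^sub>R (case T z of (t, x) \<Rightarrow> G x (v (t, x))))"
    by (auto simp: v'_def G' T_Pair)
  have "continuous_on UNIV (\<lambda>s. c *\<^sub>R dilate J \<mu> (u (a + \<mu> * s)))"
    by (intro continuous_intros bounded_linear.continuous_on[OF bounded_linear_dilate[OF \<mu>]]
        continuous_on_compose2[OF cont]) auto
  moreover have "locally_integrable v'"
    unfolding v'_def T_def using v \<mu>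
    by (intro locally_integrable_scaleR locally_integrable_scaleR_affine) auto
  moreover have "AE s in lebesgue. AE y in lebesgue. v' (s, y) = J (c *\<^sub>R dilate J \<mu> (u (a + \<mu> * s))) y"
  proof -
    have "AE s in lebesgue. AE x in lebesgue. v (a + \<mu> *\<^sub>R s, x) = J (u (a + \<mu> *\<^sub>R s)) x"
      by (rule AE_lebesgue_scaleR_affine) (use \<mu> vJ in auto)
    then show ?thesis
    proof eventually_elim
      case (elim s)
      have "AE y in lebesgue. v (a + \<mu> *\<^sub>R s, 0 + \<mu> *\<^sub>R y) = J (u (a + \<mu> *\<^sub>R s)) (0 + \<mu> *\<^sub>R y)"
        by (rule AE_lebesgue_scaleR_affine) (use \<mu> elim in auto)
      with representative_dilate[OF \<mu>, of "u (a + \<mu> * s)"]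
        representative_scaleR[of c "dilate J \<mu> (u (a + \<mu> * s))"]
      show ?case by eventually_elim (simp add: v'_def T_Pair)
    qed
  qed
  moreover have "locally_integrable (\<lambda>(s, y). G' y (v' (s, y)))"
    unfolding G'v' T_def using Gv \<mu>
    by (intro locally_integrable_scaleR locally_integrable_scaleR_affine) auto
  moreover have "weak_equation P (\<epsilon> / \<mu>) v' (\<lambda>(s, y). G' y (v' (s, y)))"
    unfolding weak_equation_def
  proof (intro allI impI)
    fix \<phi> :: "real \<times> (real ^ 'n) \<Rightarrow> complex" assume \<phi>: "test_function \<phi>"
    then have smooth: "smooth \<phi>" by (simp add: test_function_def)
    define d where "d = \<bar>\<mu>\<bar> ^ DIM(real \<times> (real ^ 'n))"
    have d: "d \<noteq> 0" using \<mu> by (simp add: d_def)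
    have cv: "(LINT z|lebesgue. f z) = d *\<^sub>R (LINT z|lebesgue. f (T z))"
      for f :: "real \<times> (real ^ 'n) \<Rightarrow> complex ^ 'q"
      unfolding d_def T_def using \<mu> by (intro integral_lebesgue_scaleR_affine) simp
    have "test_function (\<lambda>z. \<phi> (S z))"
      unfolding S_def using \<phi> \<mu> by (intro test_function_scaleR_affine) auto
    note eq = weak[unfolded weak_equation_def, rule_format, OF this]
    have "time_deriv (\<lambda>z. \<phi> (S z)) = (\<lambda>z. (1 / \<mu>) *\<^sub>R time_deriv \<phi> (S z))"
      unfolding S_def by (rule time_deriv_scaleR_affine[OF smooth])
    then have time: "(LINT z|lebesgue. time_deriv (\<lambda>z. \<phi> (S z)) z *s v z)
        = d *\<^sub>R (1 / \<mu>) *\<^sub>R (LINT z|lebesgue. time_deriv \<phi> z *s v (T z))"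
      by (subst cv) (simp add: ST vector_scalar_mult_scaleR)
    have "space_deriv \<gamma> (\<lambda>z. \<phi> (S z)) = (\<lambda>z. (1 / \<mu>) ^ (\<Sum>i\<in>UNIV. \<gamma> i) *\<^sub>R space_deriv \<gamma> \<phi> (S z))" for \<gamma>
      unfolding S_def by (rule space_deriv_scaleR_affine[OF smooth])
    then have space: "(LINT z|lebesgue. space_deriv \<gamma> (\<lambda>z. \<phi> (S z)) z *s v z)
        = d *\<^sub>R (1 / \<mu>) ^ (\<Sum>i\<in>UNIV. \<gamma> i) *\<^sub>R (LINT z|lebesgue. space_deriv \<gamma> \<phi> z *s v (T z))" for \<gamma>
      by (subst cv) (simp add: ST vector_scalar_mult_scaleR)
    have rhs: "(LINT z|lebesgue. \<phi> (S z) *s (case z of (t, x) \<Rightarrow> G x (v (t, x))))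
        = d *\<^sub>R (LINT z|lebesgue. \<phi> z *s (case T z of (t, x) \<Rightarrow> G x (v (t, x))))"
      by (subst cv) (simp add: ST)
    let ?LHS = "(- (\<epsilon> / \<mu>)) *\<^sub>R (LINT z|lebesgue. time_deriv \<phi> z *s v (T z))
        + (\<Sum>\<gamma>\<in>Poly_Mapping.keys P. (- (\<epsilon> / \<mu>)) ^ (\<Sum>i\<in>UNIV. \<gamma> i) *\<^sub>R
             (Poly_Mapping.lookup P \<gamma> *v (LINT z|lebesgue. space_deriv \<gamma> \<phi> z *s v (T z))))"
    let ?RHS = "LINT z|lebesgue. \<phi> z *s (case T z of (t, x) \<Rightarrow> G x (v (t, x)))"
    have power: "(- \<epsilon>) ^ k *\<^sub>R (A *v (d *\<^sub>R (1 / \<mu>) ^ k *\<^sub>R I)) = d *\<^sub>R (- (\<epsilon> / \<mu>)) ^ k *\<^sub>R (A *v I)"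
      for k :: nat and A :: "complex ^ 'q ^ 'q" and I
    proof -
      have "(- (\<epsilon> / \<mu>)) ^ k = (- \<epsilon>) ^ k * (1 / \<mu>) ^ k"
        unfolding power_mult_distrib[symmetric] by simp
      then show ?thesis
        by (simp add: matrix_vector_mult_scaleR mult.commute mult.left_commute)
    qed
    have time_factor: "(- \<epsilon>) *\<^sub>R d *\<^sub>R (1 / \<mu>) *\<^sub>R I = d *\<^sub>R (- (\<epsilon> / \<mu>)) *\<^sub>R I" for I :: "complex ^ 'q"
      by simp
    have "d *\<^sub>R ?LHS = d *\<^sub>R ?RHS"
      using eq unfolding time space rhs power time_factor scaleR_add_right scaleR_sum_right .
    then have "c *\<^sub>R ?LHS = c *\<^sub>R ?RHS" using d by simp
    then show "(- (\<epsilon> / \<mu>)) *\<^sub>R (LINT z|lebesgue. time_deriv \<phi> z *s v' z)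
        + (\<Sum>\<gamma>\<in>Poly_Mapping.keys P. (- (\<epsilon> / \<mu>)) ^ (\<Sum>i\<in>UNIV. \<gamma> i) *\<^sub>R
             (Poly_Mapping.lookup P \<gamma> *v (LINT z|lebesgue. space_deriv \<gamma> \<phi> z *s v' z)))
        = (LINT z|lebesgue. \<phi> z *s (case z of (s, y) \<Rightarrow> G' y (v' (s, y))))"
      unfolding G'v'
      by (simp add: v'_def vector_scalar_mult_scaleR matrix_vector_mult_scaleR scaleR_add_right
          scaleR_diff_right scaleR_sum_right scaleR_left_commute del: scaleR_scaleR scaleR_cancel_left)
  qed
  ultimately show ?thesis
    unfolding solution_def by (intro conjI exI[of _ v'])
qed

text \<open>The time \<open>s = -1/\<epsilon>\<close> corresponds to \<open>t = 0\<close>.\<close>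

definition rescale :: "real \<Rightarrow> real \<Rightarrow> (real \<Rightarrow> 'x) \<Rightarrow> real \<Rightarrow> 'x" where
  "rescale \<beta> \<epsilon> u = (\<lambda>s. (\<epsilon> powr \<beta>) *\<^sub>R dilate J \<epsilon> (u (1 + \<epsilon> * s)))"

lemma rescale_inverse:
  assumes "\<epsilon> > 0"
  shows "(\<epsilon> powr - \<beta>) *\<^sub>R dilate J (1 / \<epsilon>) (rescale \<beta> \<epsilon> u ((t - 1) / \<epsilon>)) = u t"
    and "rescale \<beta> \<epsilon> (\<lambda>t. (\<epsilon> powr - \<beta>) *\<^sub>R dilate J (1 / \<epsilon>) (\<psi> ((t - 1) / \<epsilon>))) = \<psi>"
  using assms
  by (auto simp: rescale_def linear_scale[OF linear_dilate] dilate_dilate dilate_1 powr_minus)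

lemma bij_rescale:
  assumes "\<epsilon> > 0"
  shows "bij (rescale \<beta> \<epsilon>)"
  by (rule o_bij[where g = "\<lambda>\<psi> t. (\<epsilon> powr - \<beta>) *\<^sub>R dilate J (1 / \<epsilon>) (\<psi> ((t - 1) / \<epsilon>))"])
    (auto simp: fun_eq_iff rescale_inverse[OF assms])

text \<open>The powers of \<open>\<epsilon>\<close> match because \<open>\<beta> p = \<beta> + \<delta>\<close>.  As \<open>rescale\<close> is inverted by a substitution of the same
  kind, with factor \<open>1 / \<epsilon>\<close>, both directions are instances of \<open>solution_rescale\<close>.\<close>

lemma solution_rescale_iff:
  assumes \<epsilon>: "\<epsilon> > 0" and p: "p > 1" and F: "homogeneous p F" and \<beta>: "\<beta> = \<delta> / (p - 1)"
  shows "solution J P 1 F (rescale \<beta> \<epsilon> u) \<longleftrightarrow>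
    solution J P \<epsilon> (\<lambda>x z. (\<epsilon> powr \<delta>) *\<^sub>R F ((1 / \<epsilon>) *\<^sub>R x) z) u"
    (is "?L \<longleftrightarrow> ?R")
proof
  have expo: "\<beta> * p = \<beta> + \<delta>"
    using p unfolding \<beta> by (simp add: field_simps)
  show "?R \<Longrightarrow> ?L"
    unfolding rescale_def
    using solution_rescale[of \<epsilon> F "\<epsilon> powr \<beta>" "\<lambda>x z. (\<epsilon> powr \<delta>) *\<^sub>R F ((1 / \<epsilon>) *\<^sub>R x) z" P \<epsilon> u 1]
      F \<epsilon> expo
    by (simp add: homogeneous_def powr_powr flip: powr_add)
  assume ?L
  then have "solution J P (1 / (1 / \<epsilon>)) (\<lambda>x z. (\<epsilon> powr \<delta>) *\<^sub>R F ((1 / \<epsilon>) *\<^sub>R x) z)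
      (\<lambda>t. (\<epsilon> powr - \<beta>) *\<^sub>R dilate J (1 / \<epsilon>) (rescale \<beta> \<epsilon> u (- (1 / \<epsilon>) + 1 / \<epsilon> * t)))"
    using F \<epsilon> expo
    by (intro solution_rescale[where G = F])
      (simp_all add: homogeneous_def powr_powr flip: powr_add)
  moreover have "- (1 / \<epsilon>) + 1 / \<epsilon> * t = (t - 1) / \<epsilon>" for t
    by (simp add: diff_divide_distrib)
  ultimately show ?R
    using \<epsilon> by (simp add: rescale_inverse)
qed

lemma rescale_at_initial_time:
  assumes "\<epsilon> > 0"
  shows "rescale \<beta> \<epsilon> u (- 1 / \<epsilon>) = (\<epsilon> powr \<beta>) *\<^sub>R (A + dilate J \<epsilon> \<rho>)
    \<longleftrightarrow> u 0 = dilate J (1 / \<epsilon>) A + \<rho>"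
proof -
  have dd: "dilate J \<epsilon> (dilate J (1 / \<epsilon>) A) = A" and inj: "inj (dilate J \<epsilon>)"
    using assms
    by (simp_all add: dilate_dilate dilate_1 inj_on_inverseI[where g = "dilate J (1 / \<epsilon>)"])
  have "rescale \<beta> \<epsilon> u (- 1 / \<epsilon>) = (\<epsilon> powr \<beta>) *\<^sub>R (A + dilate J \<epsilon> \<rho>)
      \<longleftrightarrow> dilate J \<epsilon> (u 0) = dilate J \<epsilon> (dilate J (1 / \<epsilon>) A + \<rho>)"
    using assms by (simp add: rescale_def linear_add[OF linear_dilate] dd)
  also have "\<dots> \<longleftrightarrow> u 0 = dilate J (1 / \<epsilon>) A + \<rho>"
    using inj by (simp add: inj_eq)
  finally show ?thesis .
qed

lemma norm_X_eps_rescale: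
  assumes "\<epsilon> > 0"
  shows "norm_X_eps J \<alpha> \<epsilon> (u t - w t) =
    \<epsilon> powr (\<alpha> - \<beta>) * norm (rescale \<beta> \<epsilon> u ((t - 1) / \<epsilon>) - rescale \<beta> \<epsilon> w ((t - 1) / \<epsilon>))"
proof -
  have "norm (rescale \<beta> \<epsilon> u ((t - 1) / \<epsilon>) - rescale \<beta> \<epsilon> w ((t - 1) / \<epsilon>))
      = \<epsilon> powr \<beta> * norm (dilate J \<epsilon> (u t - w t))"
    using assms
    by (simp add: rescale_def linear_diff[OF linear_dilate] flip: scaleR_diff_right)
  then show ?thesis
    using assms by (simp add: norm_X_eps_def powr_diff)
qed

end

section \<open>The error estimate\<close>

lemma bij_Ex1_iff: "bij f \<Longrightarrow> (\<exists>!x. Q (f x)) \<longleftrightarrow> (\<exists>!y. Q y)"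
proof -
  assume f: "bij f"
  have Q: "Q (f (inv f y)) \<longleftrightarrow> Q y" and inv: "f x = y \<longleftrightarrow> x = inv f y" for x y
    using f by (auto simp: bij_is_surj surj_f_inv_f bij_is_inj)
  show ?thesis
  proof
    assume "\<exists>!x. Q (f x)"
    then obtain x where "Q (f x)" and x: "\<And>x'. Q (f x') \<Longrightarrow> x' = x" by blast
    show "\<exists>!y. Q y"
    proof (rule ex1I)
      show "Q (f x)" by fact
      show "y = f x" if "Q y" for y
        using x[of "inv f y"] that Q[of y] inv[of x y] by auto
    qed
  next
    assume "\<exists>!y. Q y"
    then obtain y where "Q y" and y: "\<And>y'. Q y' \<Longrightarrow> y' = y" by blast
    show "\<exists>!x. Q (f x)"
    proof (rule ex1I)
      show "Q (f (inv f y))" using \<open>Q y\<close> Q by simp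
      show "x = inv f y" if "Q (f x)" for x
        using y[OF that] inv by simp
    qed
  qed
qed

theorem theorem2p7:
  fixes J :: "'x::banach \<Rightarrow> real ^ 'n::finite \<Rightarrow> complex ^ 'q::finite"
    and P :: "('n, 'q) matrix_poly"
    and F :: "real ^ 'n \<Rightarrow> complex ^ 'q \<Rightarrow> complex ^ 'q"
    and U :: "real \<Rightarrow> 'x \<Rightarrow> 'x"
    and Aplus Aminus :: "'x \<Rightarrow> real \<Rightarrow> 'x"
    and p \<alpha> \<delta> :: real
    and \<psi>m :: 'x
    and r :: "real \<Rightarrow> 'x"
  assumes "function_space J" and "dilation_invariant J"
    and "p > 1" and "homogeneous p F"
    and "assumption1a J P U" and "assumption1b J \<alpha> U" and "assumption1c \<alpha> U Aplus Aminus"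
    and "assumption4 J P F U"
    and "\<delta> > \<alpha> * (p - 1)"
    and "((\<lambda>\<epsilon>. norm_X_eps J \<alpha> \<epsilon> (r \<epsilon>)) \<longlongrightarrow> 0) (at_right 0)"
  shows "\<exists>\<epsilon>0\<in>{0<..1}.
    (\<forall>\<epsilon>\<in>{0<..\<epsilon>0}. \<exists>!u. nonlinear_problem J P F \<delta> Aminus \<psi>m r \<epsilon> u) \<and>
    (\<forall>\<epsilon>\<in>{0<..1}. \<exists>!w. linear_problem J P Aminus \<psi>m \<epsilon> w) \<and>
    (\<forall>u w. (\<forall>\<epsilon>\<in>{0<..\<epsilon>0}. nonlinear_problem J P F \<delta> Aminus \<psi>m r \<epsilon> (u \<epsilon>)) \<and>
           (\<forall>\<epsilon>\<in>{0<..1}. linear_problem J P Aminus \<psi>m \<epsilon> (w \<epsilon>)) \<longrightarrow>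
       (\<forall>\<epsilon>\<in>{0<..\<epsilon>0}. continuous_on {0..} (u \<epsilon>)) \<and>
       ((\<lambda>\<epsilon>. SUP t\<in>{0..}. ereal (norm_X_eps J \<alpha> \<epsilon> (u \<epsilon> t - w \<epsilon> t))) \<longlongrightarrow> 0) (at_right 0))"
proof -
  note J = \<open>function_space J\<close> \<open>dilation_invariant J\<close>
  define \<beta> where "\<beta> = \<delta> / (p - 1)"
  have \<beta>: "\<beta> > \<alpha>"
    using \<open>p > 1\<close> \<open>\<delta> > \<alpha> * (p - 1)\<close> by (simp add: \<beta>_def field_simps)
  let ?R = "\<lambda>\<epsilon>. rescale J \<beta> \<epsilon>"
  have U_linear: "linear (U t)" and U_norm: "norm (U t \<phi>) = norm \<phi>"
    and U_add: "U s (U t \<phi>) = U (s + t) \<phi>" and U_0: "U 0 \<phi> = \<phi>"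
    and linear_unique: "\<exists>!\<psi>. solution J P 1 (\<lambda>x z. 0) \<psi> \<and> \<psi> 0 = \<phi>"
    and linear_flow: "solution J P 1 (\<lambda>x z. 0) \<psi> \<Longrightarrow> \<psi> t = U t (\<psi> 0)" for s t \<phi> \<psi>
    using \<open>assumption1a J P U\<close> unfolding assumption1a_def by (simp_all add: fun_eq_iff)
  have U_inject: "U t \<phi> = U t \<omega> \<longleftrightarrow> \<phi> = \<omega>" for t \<phi> \<omega>
  proof
    assume "U t \<phi> = U t \<omega>"
    then have "U (- t) (U t \<phi>) = U (- t) (U t \<omega>)" by simp
    then show "\<phi> = \<omega>" by (simp add: U_add U_0)
  qed simp

  obtain T \<eta> C where "\<eta> > 0" and C: "(C \<longlongrightarrow> 0) (at_right 0)"
    and assumption4: "\<forall>t0::ereal. \<forall>\<phi>. t0 \<le> ereal (- T) \<and> norm \<phi> < \<eta> \<longrightarrow>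
      (\<exists>!\<psi>. solution J P 1 F \<psi> \<and> attains_data U t0 \<phi> \<psi>) \<and>
      (\<forall>\<psi>. solution J P 1 F \<psi> \<and> attains_data U t0 \<phi> \<psi> \<longrightarrow>
        (SUP t\<in>{t. t0 < ereal t}. ereal (norm (U (- t) (\<psi> t) - \<phi>))) \<le> ereal (C (norm \<phi>) * norm \<phi>))"
    using \<open>assumption4 J P F U\<close> unfolding assumption4_def by (elim exE conjE) (rule that)
  have unique: "\<exists>!\<psi>. solution J P 1 F \<psi> \<and> attains_data U t0 \<phi> \<psi>"
    if "t0 \<le> ereal (- T)" "norm \<phi> < \<eta>" for t0 \<phi>
    using assumption4[rule_format, of t0 \<phi>] that by simp
  have estimate: "(SUP t\<in>{t. t0 < ereal t}. ereal (norm (U (- t) (\<psi> t) - \<phi>))) \<le> ereal (C (norm \<phi>) * norm \<phi>)"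
    if "t0 \<le> ereal (- T)" "norm \<phi> < \<eta>" "solution J P 1 F \<psi>" "attains_data U t0 \<phi> \<psi>" for t0 \<phi> \<psi>
    using assumption4[rule_format, of t0 \<phi>] that by simp

  define A where "A \<epsilon> = Aminus \<psi>m (- 1 / \<epsilon>)" for \<epsilon>
  define \<rho> where "\<rho> \<epsilon> = dilate J \<epsilon> (r \<epsilon>)" for \<epsilon>
  define data where "data \<epsilon> = U (1 / \<epsilon>) ((\<epsilon> powr \<beta>) *\<^sub>R (A \<epsilon> + \<rho> \<epsilon>))" for \<epsilon>
  have nonlinear_iff: "nonlinear_problem J P F \<delta> Aminus \<psi>m r \<epsilon> u \<longleftrightarrow>
      solution J P 1 F (?R \<epsilon> u) \<and> attains_data U (ereal (- 1 / \<epsilon>)) (data \<epsilon>) (?R \<epsilon> u)"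
    if "\<epsilon> > 0" for \<epsilon> u
    using that \<open>p > 1\<close> \<open>homogeneous p F\<close>
    by (simp add: nonlinear_problem_def attains_data_def data_def A_def \<rho>_def U_inject
        solution_rescale_iff[OF J _ _ _ \<beta>_def]
        rescale_at_initial_time[OF J, where \<beta> = \<beta>, symmetric])
  \<comment> \<open>The linear equation is the case \<open>F = 0\<close>, which is homogeneous of every degree.\<close>
  have linear_iff: "linear_problem J P Aminus \<psi>m \<epsilon> w \<longleftrightarrow>
      solution J P 1 (\<lambda>x z. 0) (?R \<epsilon> w) \<and> ?R \<epsilon> w (- 1 / \<epsilon>) = (\<epsilon> powr \<beta>) *\<^sub>R A \<epsilon>"
    if "\<epsilon> > 0" for \<epsilon> w
  proof -
    have "homogeneous p (\<lambda>(x :: real ^ 'n) (z :: complex ^ 'q). 0 :: complex ^ 'q)"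
      by (simp add: homogeneous_def)
    from solution_rescale_iff[OF J that \<open>p > 1\<close> this \<beta>_def, of P w]
      rescale_at_initial_time[OF J that, of \<beta> w "A \<epsilon>" 0]
    show ?thesis
      using that by (simp add: linear_problem_def A_def linear_0[OF linear_dilate[OF J]])
  qed

  have linear_exists: "\<exists>!w. linear_problem J P Aminus \<psi>m \<epsilon> w" if \<epsilon>: "\<epsilon> > 0" for \<epsilon>
  proof -
    let ?a = "(\<epsilon> powr \<beta>) *\<^sub>R A \<epsilon>"
    have "\<psi> (- 1 / \<epsilon>) = ?a \<longleftrightarrow> \<psi> 0 = U (1 / \<epsilon>) ?a"
      if "solution J P 1 (\<lambda>x z. 0) \<psi>" for \<psi>
      unfolding linear_flow[OF that, of "- 1 / \<epsilon>"]
      using U_inject[of "1 / \<epsilon>" "U (- 1 / \<epsilon>) (\<psi> 0)" ?a] by (simp add: U_add U_0)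
    then have "\<exists>!\<psi>. solution J P 1 (\<lambda>x z. 0) \<psi> \<and> \<psi> (- 1 / \<epsilon>) = ?a"
      using linear_unique[of "U (1 / \<epsilon>) ?a"] by (simp cong: conj_cong)
    then show ?thesis
      unfolding linear_iff[OF \<epsilon>]
      by (rule bij_Ex1_iff[OF bij_rescale[OF J \<epsilon>], THEN iffD2])
  qed

  have pos: "eventually (\<lambda>\<epsilon>::real. 0 < \<epsilon>) (at_right 0)"
    by (rule eventually_at_right_less)
  have at_bot: "filterlim (\<lambda>\<epsilon>::real. - 1 / \<epsilon>) at_bot (at_right 0)"
    by real_asymp
  \<comment> \<open>\<open>V\<close> and \<open>W\<close> are the contributions of \<open>A\<^sub>-\<close> and of \<open>r\<close> to the data, multiplied by \<open>\<epsilon>\<close> to the power \<open>\<alpha> - \<beta>\<close>.\<close>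
  define V W where "V \<epsilon> = U (1 / \<epsilon>) ((\<epsilon> powr \<alpha>) *\<^sub>R A \<epsilon>)"
    and "W \<epsilon> = U (1 / \<epsilon>) ((\<epsilon> powr \<alpha>) *\<^sub>R \<rho> \<epsilon>)" for \<epsilon>
  have data_scaled: "norm (V \<epsilon> + W \<epsilon>) = \<epsilon> powr (\<alpha> - \<beta>) * norm (data \<epsilon>)" if "\<epsilon> > 0" for \<epsilon>
  proof -
    have "V \<epsilon> + W \<epsilon> = U (1 / \<epsilon>) ((\<epsilon> powr \<alpha>) *\<^sub>R (A \<epsilon> + \<rho> \<epsilon>))"
      by (simp add: V_def W_def linear_add[OF U_linear] scaleR_add_right)
    then show ?thesis
      using that by (simp add: U_norm data_def powr_diff)
  qed
  have "((\<lambda>t. norm (\<psi>m - U (- t) ((\<bar>t\<bar> powr (- \<alpha>)) *\<^sub>R Aminus \<psi>m t))) \<longlongrightarrow> 0) at_bot"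
    using \<open>assumption1c \<alpha> U Aplus Aminus\<close> by (simp add: assumption1c_def)
  from filterlim_compose[OF this at_bot]
  have "((\<lambda>\<epsilon>. norm (\<psi>m - V \<epsilon>)) \<longlongrightarrow> 0) (at_right 0)"
  proof (rule Lim_transform_eventually)
    show "\<forall>\<^sub>F \<epsilon> in at_right 0. norm (\<psi>m - U (- (- 1 / \<epsilon>)) ((\<bar>- 1 / \<epsilon>\<bar> powr (- \<alpha>)) *\<^sub>R Aminus \<psi>m (- 1 / \<epsilon>)))
        = norm (\<psi>m - V \<epsilon>)"
      using pos
    proof eventually_elim
      case (elim \<epsilon>)
      then have "\<bar>- 1 / \<epsilon>\<bar> powr (- \<alpha>) = \<epsilon> powr \<alpha>"
        by (simp add: powr_minus powr_divide)
      then show ?case by (simp add: V_def A_def)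
    qed
  qed
  then have V: "(V \<longlongrightarrow> \<psi>m) (at_right 0)"
    by (simp add: tendsto_iff dist_norm norm_minus_commute)
  have "((\<lambda>\<epsilon>. norm (W \<epsilon>)) \<longlongrightarrow> 0) (at_right 0)"
    using assms(10) by (simp add: W_def U_norm \<rho>_def norm_X_eps_def)
  then have W: "(W \<longlongrightarrow> 0) (at_right 0)"
    by (rule tendsto_norm_zero_cancel)
  have scaled: "((\<lambda>\<epsilon>. \<epsilon> powr (\<alpha> - \<beta>) * norm (data \<epsilon>)) \<longlongrightarrow> norm (\<psi>m + 0)) (at_right 0)"
  proof (rule Lim_transform_eventually)
    show "((\<lambda>\<epsilon>. norm (V \<epsilon> + W \<epsilon>)) \<longlongrightarrow> norm (\<psi>m + 0)) (at_right 0)"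
      by (intro tendsto_intros V W)
    show "\<forall>\<^sub>F \<epsilon> in at_right 0. norm (V \<epsilon> + W \<epsilon>) = \<epsilon> powr (\<alpha> - \<beta>) * norm (data \<epsilon>)"
      using pos by eventually_elim (rule data_scaled)
  qed
  have "((\<lambda>\<epsilon>. \<epsilon> powr (\<beta> - \<alpha>)) \<longlongrightarrow> 0) (at_right 0)"
    using \<beta> by real_asymp
  from tendsto_mult[OF this scaled]
  have data_0: "((\<lambda>\<epsilon>. norm (data \<epsilon>)) \<longlongrightarrow> 0 * norm (\<psi>m + 0)) (at_right 0)"
  proof (rule Lim_transform_eventually)
    show "\<forall>\<^sub>F \<epsilon> in at_right 0. \<epsilon> powr (\<beta> - \<alpha>) * (\<epsilon> powr (\<alpha> - \<beta>) * norm (data \<epsilon>)) = norm (data \<epsilon>)"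
      using pos by eventually_elim (simp add: powr_diff)
  qed
  \<comment> \<open>The value \<open>C 0\<close> is arbitrary, and the data may vanish; replacing it by \<open>0\<close> makes the function
    continuous at \<open>0\<close> from the right and does not change the product \<open>C s * s\<close>.\<close>
  define D where "D s = (if s = 0 then 0 else C s)" for s
  have "(D \<longlongrightarrow> 0) (at_right 0)"
  proof (rule Lim_transform_eventually[OF C])
    show "\<forall>\<^sub>F s in at_right 0. C s = D s"
      using pos by eventually_elim (simp add: D_def)
  qed
  then have D: "continuous (at 0 within {0..}) D"
    by (simp add: continuous_within D_def at_within_Ici_at_right)
  have D_data: "((\<lambda>\<epsilon>. D (norm (data \<epsilon>))) \<longlongrightarrow> D 0) (at_right 0)"
    by (rule continuous_within_tendsto_compose[OF D]) (use data_0 in auto)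
  have error: "((\<lambda>\<epsilon>. \<epsilon> powr (\<alpha> - \<beta>) * (C (norm (data \<epsilon>)) * norm (data \<epsilon>))) \<longlongrightarrow> 0) (at_right 0)"
  proof -
    have "\<epsilon> powr (\<alpha> - \<beta>) * norm (data \<epsilon>) * D (norm (data \<epsilon>))
        = \<epsilon> powr (\<alpha> - \<beta>) * (C (norm (data \<epsilon>)) * norm (data \<epsilon>))" for \<epsilon>
      by (simp add: D_def)
    moreover have "norm (\<psi>m + 0) * D 0 = 0"
      by (simp add: D_def)
    ultimately show ?thesis
      using tendsto_mult[OF scaled D_data] by (simp only:)
  qed

  define E where "E \<epsilon> = \<epsilon> powr (\<alpha> - \<beta>) * (C (norm (data \<epsilon>)) * norm (data \<epsilon>)) + norm_X_eps J \<alpha> \<epsilon> (r \<epsilon>)" for \<epsilon>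
  have E_0: "(E \<longlongrightarrow> 0) (at_right 0)"
    using tendsto_add[OF error assms(10)] by (simp add: E_def[abs_def])
  have "eventually (\<lambda>\<epsilon>. norm (data \<epsilon>) < \<eta>) (at_right 0)"
    using order_tendstoD(2)[OF data_0, of \<eta>] \<open>\<eta> > 0\<close> by simp
  moreover have "eventually (\<lambda>\<epsilon>. - 1 / \<epsilon> \<le> - T) (at_right 0)"
    using at_bot unfolding filterlim_at_bot by blast
  ultimately have "eventually (\<lambda>\<epsilon>. norm (data \<epsilon>) < \<eta> \<and> - 1 / \<epsilon> \<le> - T) (at_right 0)"
    by (rule eventually_conj)
  then obtain b where "b > 0" and b: "\<And>\<epsilon>. 0 < \<epsilon> \<Longrightarrow> \<epsilon> < b \<Longrightarrow> norm (data \<epsilon>) < \<eta> \<and> - 1 / \<epsilon> \<le> - T"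
    unfolding eventually_at_right_field by blast
  define \<epsilon>0 where "\<epsilon>0 = min 1 (b / 2)"
  have small: "norm (data \<epsilon>) < \<eta>" "ereal (- 1 / \<epsilon>) \<le> ereal (- T)"
    if "\<epsilon> \<in> {0<..\<epsilon>0}" for \<epsilon>
    using \<open>b > 0\<close> b[of \<epsilon>] that by (auto simp: \<epsilon>0_def)
  have "\<epsilon>0 \<in> {0<..1}" using \<open>b > 0\<close> by (simp add: \<epsilon>0_def)

  have bound: "norm_X_eps J \<alpha> \<epsilon> (u t - w t) \<le> E \<epsilon>"
    if \<epsilon>: "\<epsilon> \<in> {0<..\<epsilon>0}" and u: "nonlinear_problem J P F \<delta> Aminus \<psi>m r \<epsilon> u"
      and w: "linear_problem J P Aminus \<psi>m \<epsilon> w" and "t \<ge> 0" for \<epsilon> u w t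
  proof -
    have "\<epsilon> > 0" using \<epsilon> by simp
    define \<psi> \<phi> s where "\<psi> = ?R \<epsilon> u" and "\<phi> = ?R \<epsilon> w" and "s = (t - 1) / \<epsilon>"
    have s: "s \<ge> - 1 / \<epsilon>"
      using \<open>t \<ge> 0\<close> \<open>\<epsilon> > 0\<close> by (simp add: s_def diff_divide_distrib)
    have \<psi>: "solution J P 1 F \<psi>" "attains_data U (ereal (- 1 / \<epsilon>)) (data \<epsilon>) \<psi>"
      using u nonlinear_iff[OF \<open>\<epsilon> > 0\<close>] by (simp_all add: \<psi>_def)
    have \<phi>: "solution J P 1 (\<lambda>x z. 0) \<phi>" "\<phi> (- 1 / \<epsilon>) = (\<epsilon> powr \<beta>) *\<^sub>R A \<epsilon>"
      using w linear_iff[OF \<open>\<epsilon> > 0\<close>] by (simp_all add: \<phi>_def)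
    have free: "U (- t) (\<phi> t) = \<phi> 0" for t
      using linear_flow[OF \<phi>(1), of t] by (simp add: U_add U_0)
    have "data \<epsilon> - \<phi> 0 = U (1 / \<epsilon>) ((\<epsilon> powr \<beta>) *\<^sub>R \<rho> \<epsilon>)"
      using free[of "- 1 / \<epsilon>"] \<phi>(2) by (simp add: data_def scaleR_add_right linear_add[OF U_linear])
    then have data_diff: "norm (data \<epsilon> - \<phi> 0) = \<epsilon> powr \<beta> * norm (\<rho> \<epsilon>)"
      by (simp add: U_norm)
    have sup: "norm (U (- s') (\<psi> s') - data \<epsilon>) \<le> C (norm (data \<epsilon>)) * norm (data \<epsilon>)"
      if "s' > - 1 / \<epsilon>" for s'
    proof -
      have "ereal (norm (U (- s') (\<psi> s') - data \<epsilon>)) \<le>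
          (SUP t\<in>{t. ereal (- 1 / \<epsilon>) < ereal t}. ereal (norm (U (- t) (\<psi> t) - data \<epsilon>)))"
        using that by (intro SUP_upper) simp
      also have "\<dots> \<le> ereal (C (norm (data \<epsilon>)) * norm (data \<epsilon>))"
        by (rule estimate[OF small(2,1)[OF \<epsilon>] \<psi>])
      finally show ?thesis by simp
    qed
    have "norm (U (- s) (\<psi> s) - data \<epsilon>) \<le> C (norm (data \<epsilon>)) * norm (data \<epsilon>)"
      \<comment> \<open>The supremum in the estimate is over times strictly after the initial one.  At the initial
        time the left-hand side vanishes; the right-hand side is nonnegative because it bounds a norm
        at a later time.\<close>
    proof (cases "s = - 1 / \<epsilon>")
      case True
      then have "norm (U (- s) (\<psi> s) - data \<epsilon>) = 0"
        using \<psi>(2) by (simp add: attains_data_def)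
      also have "\<dots> \<le> norm (U (- 0) (\<psi> 0) - data \<epsilon>)" by simp
      also have "\<dots> \<le> C (norm (data \<epsilon>)) * norm (data \<epsilon>)"
        using sup[of 0] \<open>\<epsilon> > 0\<close> by simp
      finally show ?thesis .
    qed (use s sup in simp)
    \<comment> \<open>The group preserves norms, so both solutions may be compared after being pulled back to time
      \<open>0\<close>, where the linear one is constant.\<close>
    moreover have "norm (\<psi> s - \<phi> s) = norm (U (- s) (\<psi> s) - \<phi> 0)"
      using U_norm[of "- s" "\<psi> s - \<phi> s"] by (simp add: linear_diff[OF U_linear] free)
    moreover have "norm (U (- s) (\<psi> s) - \<phi> 0) \<le> norm (U (- s) (\<psi> s) - data \<epsilon>) + norm (data \<epsilon> - \<phi> 0)"
      using norm_triangle_ineq[of "U (- s) (\<psi> s) - data \<epsilon>" "data \<epsilon> - \<phi> 0"] by simp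
    ultimately have "norm (\<psi> s - \<phi> s) \<le> C (norm (data \<epsilon>)) * norm (data \<epsilon>) + \<epsilon> powr \<beta> * norm (\<rho> \<epsilon>)"
      using data_diff by linarith
    then have "\<epsilon> powr (\<alpha> - \<beta>) * norm (\<psi> s - \<phi> s)
        \<le> \<epsilon> powr (\<alpha> - \<beta>) * (C (norm (data \<epsilon>)) * norm (data \<epsilon>) + \<epsilon> powr \<beta> * norm (\<rho> \<epsilon>))"
      by (intro mult_left_mono) auto
    also have "\<dots> = E \<epsilon>"
      using \<open>\<epsilon> > 0\<close> by (simp add: E_def \<rho>_def norm_X_eps_def powr_diff distrib_left)
    finally show ?thesis
      unfolding norm_X_eps_rescale[OF J \<open>\<epsilon> > 0\<close>, where \<beta> = \<beta>] \<psi>_def \<phi>_def s_def .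
  qed

  show ?thesis
  proof (intro bexI[of _ \<epsilon>0] conjI ballI allI impI)
    fix \<epsilon> assume \<epsilon>: "\<epsilon> \<in> {0<..\<epsilon>0}"
    then have "\<epsilon> > 0" by simp
    show "\<exists>!u. nonlinear_problem J P F \<delta> Aminus \<psi>m r \<epsilon> u"
      unfolding nonlinear_iff[OF \<open>\<epsilon> > 0\<close>]
      using unique[OF small(2,1)[OF \<epsilon>]]
      by (rule bij_Ex1_iff[OF bij_rescale[OF J \<open>\<epsilon> > 0\<close>], THEN iffD2])
  next
    fix \<epsilon> :: real assume "\<epsilon> \<in> {0<..1}"
    then show "\<exists>!w. linear_problem J P Aminus \<psi>m \<epsilon> w"
      by (simp add: linear_exists)
  next
    fix u w \<epsilon>
    assume "(\<forall>\<epsilon>\<in>{0<..\<epsilon>0}. nonlinear_problem J P F \<delta> Aminus \<psi>m r \<epsilon> (u \<epsilon>)) \<and>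
      (\<forall>\<epsilon>\<in>{0<..1}. linear_problem J P Aminus \<psi>m \<epsilon> (w \<epsilon>))" and "\<epsilon> \<in> {0<..\<epsilon>0}"
    then have "nonlinear_problem J P F \<delta> Aminus \<psi>m r \<epsilon> (u \<epsilon>)" by blast
    then show "continuous_on {0..} (u \<epsilon>)"
      unfolding nonlinear_problem_def solution_def by (blast intro: continuous_on_subset)
  next
    fix u w
    assume uw: "(\<forall>\<epsilon>\<in>{0<..\<epsilon>0}. nonlinear_problem J P F \<delta> Aminus \<psi>m r \<epsilon> (u \<epsilon>)) \<and>
      (\<forall>\<epsilon>\<in>{0<..1}. linear_problem J P Aminus \<psi>m \<epsilon> (w \<epsilon>))"
    have ev: "eventually (\<lambda>\<epsilon>. \<epsilon> \<in> {0<..\<epsilon>0}) (at_right 0)"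
      using \<open>\<epsilon>0 \<in> {0<..1}\<close> by (auto simp: eventually_at_right_field intro!: exI[of _ \<epsilon>0])
    show "((\<lambda>\<epsilon>. SUP t\<in>{0..}. ereal (norm_X_eps J \<alpha> \<epsilon> (u \<epsilon> t - w \<epsilon> t))) \<longlongrightarrow> 0) (at_right 0)"
    proof (rule tendsto_sandwich)
      show "eventually (\<lambda>\<epsilon>. 0 \<le> (SUP t\<in>{0..}. ereal (norm_X_eps J \<alpha> \<epsilon> (u \<epsilon> t - w \<epsilon> t)))) (at_right 0)"
        by (intro always_eventually allI SUP_upper2[of 0]) (auto simp: norm_X_eps_def)
      show "eventually (\<lambda>\<epsilon>. (SUP t\<in>{0..}. ereal (norm_X_eps J \<alpha> \<epsilon> (u \<epsilon> t - w \<epsilon> t))) \<le> ereal (E \<epsilon>)) (at_right 0)"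
        using ev
      proof eventually_elim
        case (elim \<epsilon>)
        with uw \<open>\<epsilon>0 \<in> {0<..1}\<close> have "nonlinear_problem J P F \<delta> Aminus \<psi>m r \<epsilon> (u \<epsilon>)"
          and "linear_problem J P Aminus \<psi>m \<epsilon> (w \<epsilon>)" by auto
        then show ?case
          by (intro SUP_least) (simp add: bound[OF elim])
      qed
      show "((\<lambda>\<epsilon>. ereal (E \<epsilon>)) \<longlongrightarrow> 0) (at_right 0)"
        using tendsto_ereal[OF E_0] by (simp add: zero_ereal_def)
    qed simp
  qed (fact \<open>\<epsilon>0 \<in> {0<..1}\<close>)
qed

end
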